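(* Let $\mathbb{G}$ be a homogeneous group of step $\iota$ and topological dimension $\mathrm q$, and let $d$ be a multiradial distance on $\mathbb{G}$. Then for all integers $1\le n_1,n_2,\dots,n_\iota\le\mathrm q-1$ such that the family $\mathcal{F}_{n_1,\dots,n_\iota}$ is nonempty, the distance $d$ is rotationally symmetric with respect to $\mathcal{F}_{n_1,\dots,n_\iota}$; that is, there is a constant $\omega(\mathcal{F}_{n_1,\dots,n_\iota})$ such that, with $n=n_1+\cdots+n_\iota$, $$\omega(\mathcal{F}_{n_1,\dots,n_\iota})=\beta_d(V)=\mathcal{H}^n_{|\cdot|}(V\cap\mathbb{B}(0,1))\qquad\text{for all }V\in\mathcal{F}_{n_1,\dots,n_\iota}.$$
   Context: **Homogeneous groups.** A graded group of step $\iota$ is a connected, simply connected, nilpotent Lie group whose Lie algebra is a direct sum $H_1\oplus\cdots\oplus H_\iota$ with $[H_i,H_j]\subset H_{i+j}$ ($H_k=\{0\}$ for $k>\iota$) and $H_\iota\neq\{0\}$. Through the exponential map it is identified with its Lie algebra, so $\mathbb{G}=H_1\oplus\cdots\oplus H_\iota$ is a finite-dimensional real vector space with the group product given by the Baker–Campbell–Hausdorff formula; the unit is $0$. $P_{H_j}:\mathbb{G}\to H_j$ are the linear projections. Dilations $\delta_r$, $r>0$, are the linear maps acting as multiplication by $r^i$ on $H_i$; with them $\mathbb{G}$ is a homogeneous group. A homogeneous distance $d$ is a distance with $d(zx,zy)=d(x,y)$ and $d(\delta_rx,\delta_ry)=r\,d(x,y)$ for all $x,y,z\in\mathbb{G}$,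 $r>0$. $\mathbb{B}(x,r)=\{y: d(x,y)\le r\}$. A scalar product on $\mathbb{G}$ making the layers $H_i$ mutually orthogonal is fixed, with norm $|\cdot|$; $\mathcal{H}^n_{|\cdot|}$ is the $n$-dimensional Euclidean Hausdorff measure (normalized to agree with Lebesgue measure on $n$-planes). A homogeneous subspace is a linear subspace invariant under all $\delta_r$. **Multiradial distance.** A homogeneous distance $d$ is multiradial if there is a continuous $\varphi:[0,+\infty)^\iota\to[0,+\infty)$, nondecreasing in each variable, with $\varphi(0)=0$, $\varphi(t)\to+\infty$ as $|t|\to+\infty$, and $\mathbb{B}(0,1)=\{x\in\mathbb{G}:\varphi(|P_{H_1}(x)|,\dots,|P_{H_\iota}(x)|)\le1\}$. **Spherical factor and rotational symmetry.** For a linear subspace $V\subset\mathbb{G}$ of dimension $n$, $\beta_d(V)=\max_{z\in\mathbb{B}(0,1)}\mathcal{H}^n_{|\cdot|}(V\cap\mathbb{B}(z,1))$. $d$ is rotationally symmetric with respect to a nonempty class $\mathcal{F}$ of homogeneous subspaces if $\beta_d$ is constant on $\mathcal{F}$. $\mathcal{F}_{n_1,\dots,n_\iota}$ is the family of all homogeneous subspaces $V=V_1\oplus\cdots\oplus V_\iota\subset\mathbb{G}$ with $V_i\subset H_i$ and $\dim V_i=n_i$ for $i=1,\dots,\iota$. *)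

theory Defs
  imports "HOL-Analysis.Analysis"
begin

text \<open>
  A graded group is identified with its Lie algebra through the exponential map. The underlying
  Euclidean space is the type \<open>'a\<close>, whose inner product is the fixed scalar product;
  \<open>br\<close> is the Lie bracket and \<open>H i\<close> is the layer of degree \<open>i\<close>. The values of \<open>H\<close> at \<open>0\<close> and
  above the step \<open>\<iota>\<close> carry no information (the latter are trivial).
\<close>

locale graded_group =
  fixes br :: "'a::euclidean_space \<Rightarrow> 'a \<Rightarrow> 'a"
    and H :: "nat \<Rightarrow> 'a set"
    and \<iota> :: nat
  assumes bilinear_br: "bilinear br"
    and br_self: "br x x = 0"
    and jacobi: "br x (br y z) + br y (br z x) + br z (br x y) = 0"
    and step_pos: "1 \<le> \<iota>"
    and subspace_layer: "1 \<le> i \<Longrightarrow> subspace (H i)"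
    and direct_sum: "\<exists>!f. f \<in> PiE {1..\<iota>} H \<and> x = (\<Sum>i\<in>{1..\<iota>}. f i)"
    and br_layers: "\<lbrakk>1 \<le> i; 1 \<le> j; x \<in> H i; y \<in> H j\<rbrakk> \<Longrightarrow> br x y \<in> H (i + j)"
    and layer_above: "\<iota> < k \<Longrightarrow> H k = {0}"
    and layer_top: "H \<iota> \<noteq> {0}"
    and orthogonal_layers:
      "\<lbrakk>i \<in> {1..\<iota>}; j \<in> {1..\<iota>}; i \<noteq> j; x \<in> H i; y \<in> H j\<rbrakk> \<Longrightarrow> orthogonal x y"

text \<open>The linear projection onto \<open>H j\<close> associated with the direct sum decomposition.\<close>

definition layer_proj :: "(nat \<Rightarrow> 'a::euclidean_space set) \<Rightarrow> nat \<Rightarrow> nat \<Rightarrow> 'a \<Rightarrow> 'a" where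
  "layer_proj H \<iota> j x = (THE f. f \<in> PiE {1..\<iota>} H \<and> x = (\<Sum>i\<in>{1..\<iota>}. f i)) j"

definition dilation :: "(nat \<Rightarrow> 'a::euclidean_space set) \<Rightarrow> nat \<Rightarrow> real \<Rightarrow> 'a \<Rightarrow> 'a" where
  "dilation H \<iota> r x = (\<Sum>i\<in>{1..\<iota>}. r ^ i *\<^sub>R layer_proj H \<iota> i x)"

text \<open>
  The Baker--Campbell--Hausdorff product in Dynkin's form. A list
  \<open>[(r\<^sub>1, s\<^sub>1), \<dots>, (r\<^sub>k, s\<^sub>k)]\<close> stands for the right-nested bracket of the word
  $x^{r_1} y^{s_1} \cdots x^{r_k} y^{s_k}$, which occurs with the coefficient
  $(-1)^{k-1} / (k \, \sum_i (r_i + s_i) \, \prod_i r_i! \, s_i!)$. In a graded Lie algebra of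
  step \<open>\<iota>\<close> all brackets of more than \<open>\<iota>\<close> elements vanish, so that the series is the finite
  sum over the words of length at most \<open>\<iota>\<close>.
\<close>

fun nested_br :: "('a::real_vector \<Rightarrow> 'a \<Rightarrow> 'a) \<Rightarrow> 'a list \<Rightarrow> 'a" where
  "nested_br br [] = 0"
| "nested_br br [x] = x"
| "nested_br br (x # y # zs) = br x (nested_br br (y # zs))"

definition bch_word :: "'a \<Rightarrow> 'a \<Rightarrow> (nat \<times> nat) list \<Rightarrow> 'a list" where
  "bch_word x y ps = concat (map (\<lambda>(r, s). replicate r x @ replicate s y) ps)"

definition bch_degree :: "(nat \<times> nat) list \<Rightarrow> nat" where
  "bch_degree ps = (\<Sum>(r, s)\<leftarrow>ps. r + s)"

definition bch_coeff :: "(nat \<times> nat) list \<Rightarrow> real" where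
  "bch_coeff ps = (-1) ^ (length ps - 1) /
     (real (length ps) * real (bch_degree ps) * (\<Prod>(r, s)\<leftarrow>ps. fact r * fact s))"

definition group_mult ::
  "('a::real_vector \<Rightarrow> 'a \<Rightarrow> 'a) \<Rightarrow> nat \<Rightarrow> 'a \<Rightarrow> 'a \<Rightarrow> 'a" where
  "group_mult br \<iota> x y =
     (\<Sum>ps | ps \<noteq> [] \<and> (\<forall>(r, s)\<in>set ps. 0 < r + s) \<and> bch_degree ps \<le> \<iota>.
        bch_coeff ps *\<^sub>R nested_br br (bch_word x y ps))"

definition homogeneous_distance ::
  "('a::euclidean_space \<Rightarrow> 'a \<Rightarrow> 'a) \<Rightarrow> (nat \<Rightarrow> 'a set) \<Rightarrow> nat \<Rightarrow> ('a \<Rightarrow> 'a \<Rightarrow> real) \<Rightarrow> bool" where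
  "homogeneous_distance br H \<iota> d \<longleftrightarrow>
     Metric_space UNIV d \<and>
     (\<forall>x y z. d (group_mult br \<iota> z x) (group_mult br \<iota> z y) = d x y) \<and>
     (\<forall>x y. \<forall>r>0. d (dilation H \<iota> r x) (dilation H \<iota> r y) = r * d x y)"

abbreviation closed_ball :: "('a \<Rightarrow> 'a \<Rightarrow> real) \<Rightarrow> 'a \<Rightarrow> real \<Rightarrow> 'a set" where
  "closed_ball d \<equiv> Metric_space.mcball UNIV d"

text \<open>
  Points of $[0,+\infty)^\iota$ are the extensional functions \<open>t \<in> {1..\<iota>} \<rightarrow>\<^sub>E {0..}\<close>, and
  \<open>L2_set t {1..\<iota>}\<close> is their Euclidean norm.
\<close>

definition multiradial_distance ::
  "('a::euclidean_space \<Rightarrow> 'a \<Rightarrow> 'a) \<Rightarrow> (nat \<Rightarrow> 'a set) \<Rightarrow> nat \<Rightarrow> ('a \<Rightarrow> 'a \<Rightarrow> real) \<Rightarrow> bool" where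
  "multiradial_distance br H \<iota> d \<longleftrightarrow>
     homogeneous_distance br H \<iota> d \<and>
     (\<exists>\<phi> :: (nat \<Rightarrow> real) \<Rightarrow> real.
        continuous_map (product_topology (\<lambda>_. top_of_set {0..}) {1..\<iota>}) (top_of_set {0..}) \<phi> \<and>
        (\<forall>t \<in> {1..\<iota>} \<rightarrow>\<^sub>E {0..}. \<forall>i\<in>{1..\<iota>}. \<forall>s\<ge>t i. \<phi> t \<le> \<phi> (t(i := s))) \<and>
        \<phi> (\<lambda>i\<in>{1..\<iota>}. 0) = 0 \<and>
        (\<forall>M. \<exists>R. \<forall>t \<in> {1..\<iota>} \<rightarrow>\<^sub>E {0..}. R \<le> L2_set t {1..\<iota>} \<longrightarrow> M \<le> \<phi> t) \<and>
        closed_ball d 0 1 = {x. \<phi> (\<lambda>i\<in>{1..\<iota>}. norm (layer_proj H \<iota> i x)) \<le> 1})"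

text \<open>
  The \<open>n\<close>-dimensional Hausdorff (outer) measure of the Euclidean distance. The factor
  \<open>unit_ball_vol n / 2 ^ n\<close> is the standard one, for which the measure agrees with Lebesgue
  measure on \<open>n\<close>-planes. Boundedness of the covering sets is required because \<open>diameter\<close> is \<open>0\<close>
  on unbounded sets; empty covering sets contribute nothing, also for \<open>n = 0\<close>.
\<close>

definition hausdorff_measure :: "nat \<Rightarrow> 'a::euclidean_space set \<Rightarrow> ennreal" where
  "hausdorff_measure n S =
     (SUP \<delta>\<in>{0<..}.
        INF E\<in>{E :: nat \<Rightarrow> 'a set. S \<subseteq> (\<Union>k. E k) \<and> (\<forall>k. bounded (E k) \<and> diameter (E k) \<le> \<delta>)}.
          \<Sum>k. if E k = {} then 0
              else ennreal (unit_ball_vol (real n) * (diameter (E k) / 2) ^ n))"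

text \<open>
  The spherical factor is a maximum in the source; it is stated here as a supremum, which always
  exists in \<open>ennreal\<close>.
\<close>

definition spherical_factor ::
  "('a::euclidean_space \<Rightarrow> 'a \<Rightarrow> real) \<Rightarrow> 'a set \<Rightarrow> ennreal" where
  "spherical_factor d V =
     (SUP z\<in>closed_ball d 0 1. hausdorff_measure (dim V) (V \<inter> closed_ball d z 1))"

definition homogeneous_subspace ::
  "(nat \<Rightarrow> 'a::euclidean_space set) \<Rightarrow> nat \<Rightarrow> 'a set \<Rightarrow> bool" where
  "homogeneous_subspace H \<iota> V \<longleftrightarrow> subspace V \<and> (\<forall>r>0. dilation H \<iota> r ` V \<subseteq> V)"

definition rotationally_symmetric ::
  "(nat \<Rightarrow> 'a::euclidean_space set) \<Rightarrow> nat \<Rightarrow> ('a \<Rightarrow> 'a \<Rightarrow> real) \<Rightarrow> 'a set set \<Rightarrow> bool" where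
  "rotationally_symmetric H \<iota> d F \<longleftrightarrow>
     F \<noteq> {} \<and> (\<forall>V\<in>F. homogeneous_subspace H \<iota> V) \<and>
     (\<forall>V\<in>F. \<forall>W\<in>F. spherical_factor d V = spherical_factor d W)"

definition subspace_family ::
  "(nat \<Rightarrow> 'a::euclidean_space set) \<Rightarrow> nat \<Rightarrow> (nat \<Rightarrow> nat) \<Rightarrow> 'a set set" where
  "subspace_family H \<iota> n =
     {V. homogeneous_subspace H \<iota> V \<and>
         (\<exists>W. (\<forall>i\<in>{1..\<iota>}. subspace (W i) \<and> W i \<subseteq> H i \<and> dim (W i) = n i) \<and>
              V = {\<Sum>i\<in>{1..\<iota>}. f i | f. f \<in> PiE {1..\<iota>} W})}"

end

theory Submission
  imports Defs
begin

text \<open>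
  Since the inverse of \<open>z\<close> is \<open>- z\<close>, a point \<open>x\<close> lies in the unit ball around \<open>z\<close> iff \<open>(- z) x\<close> lies in
  the unit ball around \<open>0\<close>. For \<open>x \<in> V\<close> let \<open>T x\<close> be the orthogonal projection of \<open>(- z) x\<close> to
  \<open>V\<close>. Projecting decreases the norms of all layers, so for a multiradial distance \<open>T\<close> maps the slice
  of the ball around \<open>z\<close> into the slice of the ball around \<open>0\<close>. By the
  Baker--Campbell--Hausdorff formula \<open>T\<close> adds to the \<open>j\<close>-th layer of \<open>x\<close> a term that depends only on
  the layers below \<open>j\<close>; hence \<open>T\<close> is a composition of shears and preserves the Hausdorff measure on
  \<open>V\<close>. So the maximum is attained at \<open>z = 0\<close>. Two subspaces of the family are related by
  a linear isometry that preserves the norm of each layer, which maps one slice of the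
  unit ball onto the other.

  No comparison of the Hausdorff measure with Lebesgue measure is needed: it suffices that the Hausdorff
  measure on \<open>V\<close> is \<open>\<sigma>\<close>-finite and invariant under translations by \<open>V\<close>.
\<close>

section \<open>Metric outer measures\<close>

text \<open>The hard half of Caratheodory's criterion. The sets \<open>D k\<close> of points of
  \<open>X\<close> at distance at least \<open>1 / (k + 1)\<close> from \<open>C\<close> exhaust
  \<open>X - C\<close>. Rings \<open>R k\<close> of equal parity are a positive distance apart, so
  their measures add up to at most \<open>f X\<close>. The sum over all rings therefore converges,
  its tails tend to 0, and \<open>f (D N)\<close> approximates \<open>f (X - C)\<close>.\<close>

lemma metric_outer_measure_closed:
  fixes f :: "'a::metric_space set \<Rightarrow> ennreal"
  assumes oms: "outer_measure_space UNIV f"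
    and sep: "\<And>S T e. 0 < e \<Longrightarrow> (\<And>x y. x \<in> S \<Longrightarrow> y \<in> T \<Longrightarrow> e \<le> dist x y) \<Longrightarrow>
      f S + f T \<le> f (S \<union> T)"
    and C: "closed C"
  shows "f (X \<inter> C) + f (X - C) \<le> f X"
proof -
  have mono: "f S \<le> f T" if "S \<subseteq> T" for S T
    using oms that by (auto simp: outer_measure_space_def increasing_def)
  have f0: "f {} = 0"
    using oms by (auto simp: outer_measure_space_def positive_def)
  have csa: "countably_subadditive UNIV f"
    using oms by (auto simp: outer_measure_space_def)
  have sa: "f (S \<union> T) \<le> f S + f T" for S T
  proof -
    have "subadditive UNIV f"
      using ring_of_sets.countably_subadditive_subadditive[of UNIV UNIV f] oms
      by (auto simp: outer_measure_space_def ring_of_sets_iff)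
    then have "f (S \<union> (T - S)) \<le> f S + f (T - S)"
      unfolding subadditive_def by blast
    also have "\<dots> \<le> f S + f T"
      by (intro add_mono mono) auto
    finally show ?thesis by simp
  qed
  show ?thesis
  \<comment> \<open>\<open>infdist\<close> to the empty set is 0 by convention, so the rings are
    meaningful only for \<open>C \<noteq> {}\<close>; finiteness of \<open>f X\<close> makes the
    series of ring measures converge.\<close>
  proof (cases "C = {} \<or> f X = top")
    case True
    then show ?thesis by (auto simp: f0)
  next
    case False
    then have "C \<noteq> {}" and fin: "f X \<noteq> top" by auto
    define D where "D k = {x\<in>X. 1 / real (Suc k) \<le> infdist x C}" for k
    define R where "R k = D (Suc k) - D k" for k
    have infd: "infdist x C \<le> infdist y C + dist x y" for x y
      using infdist_triangle[of x C y] by simp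
    have D_mono: "D k \<subseteq> D l" if "k \<le> l" for k l
    proof -
      have "1 / real (Suc l) \<le> 1 / real (Suc k)"
        using that by (simp add: frac_le)
      then show ?thesis by (auto simp: D_def)
    qed
    have parity_sum: "(\<Sum>k<N. f (R (2 * k + p))) \<le> f (\<Union>k<N. R (2 * k + p))" for N p
    proof (induction N)
      case 0
      show ?case by simp
    next
      case (Suc N)
      define a where "a = 2 * N + p"
      have "f (\<Union>k<N. R (2 * k + p)) + f (R a) \<le> f ((\<Union>k<N. R (2 * k + p)) \<union> R a)"
      proof (cases "N = 0")
        case True
        then show ?thesis by (simp add: f0)
      next
        case False
        then have a: "0 < a" by (simp add: a_def)
        show ?thesis
        proof (rule sep)
          \<comment> \<open>The ring \<open>a - 1\<close> is skipped: earlier rings of the same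
            parity lie in \<open>D (a - 1)\<close>, hence at distance at least \<open>1 / a\<close>
            from \<open>C\<close>, while \<open>R a\<close> stays closer to \<open>C\<close> than
            \<open>1 / (a + 1)\<close>.\<close>
          show "0 < 1 / real a - 1 / real (Suc a)"
            using a by (simp add: field_simps add_pos_pos)
          fix x y assume "x \<in> (\<Union>k<N. R (2 * k + p))" and y: "y \<in> R a"
          then obtain k where "k < N" "x \<in> D (Suc (2 * k + p))"
            by (auto simp: R_def)
          moreover from this have "Suc (2 * k + p) \<le> a - 1"
            by (simp add: a_def)
          ultimately have "x \<in> D (a - 1)"
            using D_mono by blast
          then have "1 / real a \<le> infdist x C"
            using a by (simp add: D_def)
          moreover have "infdist y C < 1 / real (Suc a)"
            using y by (auto simp: R_def D_def)
          ultimately show "1 / real a - 1 / real (Suc a) \<le> dist x y"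
            using infd[of x y] by linarith
        qed
      qed
      moreover have "(\<Sum>k<Suc N. f (R (2 * k + p))) \<le> f (\<Union>k<N. R (2 * k + p)) + f (R a)"
        using Suc by (simp add: a_def add_right_mono)
      moreover have "(\<Union>k<N. R (2 * k + p)) \<union> R a = (\<Union>k<Suc N. R (2 * k + p))"
        by (auto simp: a_def lessThan_Suc)
      ultimately show ?case by auto
    qed
    have "(\<Sum>k. f (R k)) \<le> f X + f X"
    proof (rule suminf_le_const)
      fix N
      have "(\<Sum>k<N. f (R k)) \<le> (\<Sum>k<2 * N. f (R k))"
        by (rule sum_mono2) auto
      also have "\<dots> = (\<Sum>k<N. f (R (2 * k + 0))) + (\<Sum>k<N. f (R (2 * k + 1)))"
        by (induction N) (auto simp: algebra_simps)
      also have "\<dots> \<le> f X + f X"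
        by (intro add_mono order_trans[OF parity_sum] mono) (auto simp: R_def D_def)
      finally show "(\<Sum>k<N. f (R k)) \<le> f X + f X" .
    qed (rule summableI)
    then have fin_sum: "(\<Sum>k. f (R k)) \<noteq> top"
      using fin by (auto simp: top_unique)
    have fin_R: "f (R k) \<noteq> top" for k
    proof -
      have "R k \<subseteq> X" by (auto simp: R_def D_def)
      then show ?thesis using fin mono by (metis top_unique)
    qed
    define r where "r k = enn2real (f (R k))" for k
    have r: "f (R k) = ennreal (r k)" "0 \<le> r k" for k
      using fin_R by (auto simp: r_def less_top)
    have summ: "summable r"
      using fin_sum r by (intro summable_suminf_not_top) auto
    have cover: "X - C \<subseteq> D N \<union> (\<Union>k. R (k + N))" for N
    proof
      fix x assume x: "x \<in> X - C"
      then have "0 < infdist x C"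
        using \<open>C \<noteq> {}\<close> C by (metis DiffD2 infdist_pos_not_in_closed)
      then obtain m where "1 / real (Suc m) < infdist x C"
        using nat_approx_posE by blast
      then have "x \<in> D m" using x by (simp add: D_def)
      \<comment> \<open>If the first index \<open>l\<close> with \<open>x \<in> D l\<close> exceeds
        \<open>N\<close>, then \<open>x\<close> lies in the ring \<open>l - 1\<close>.\<close>
      define l where "l = (LEAST l. x \<in> D l)"
      have l: "x \<in> D l" using \<open>x \<in> D m\<close> unfolding l_def by (rule LeastI)
      show "x \<in> D N \<union> (\<Union>k. R (k + N))"
      proof (cases "l \<le> N")
        case True
        then show ?thesis using D_mono l by blast
      next
        case False
        then have "l - 1 < l" by simp
        then have "x \<notin> D (l - 1)" unfolding l_def by (rule not_less_Least)
        then have "x \<in> R (l - 1 - N + N)" using l False by (simp add: R_def)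
        then show ?thesis by blast
      qed
    qed
    show ?thesis
    proof (rule ennreal_le_epsilon)
      fix e :: real assume "0 < e"
      then obtain N where N: "\<And>n. N \<le> n \<Longrightarrow> norm (\<Sum>i. r (i + n)) < e"
        using suminf_exist_split[OF _ summ] by blast
      \<comment> \<open>\<open>countably_subadditive\<close> speaks of disjoint families
        only.\<close>
      have disj: "disjoint_family (\<lambda>k. R (k + N))"
      proof -
        have "R i \<inter> R j = {}" if "i < j" for i j
          using that D_mono[of "Suc i" j] by (auto simp: R_def)
        then have "R (i + N) \<inter> R (j + N) = {}" if "i \<noteq> j" for i j
          using that by (metis Int_commute add_less_cancel_right linorder_neqE_nat)
        then show ?thesis
          by (simp add: disjoint_family_on_def)
      qed
      have "f (X - C) \<le> f (D N) + f (\<Union>k. R (k + N))"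
        using order_trans[OF mono[OF cover] sa] .
      also have "f (\<Union>k. R (k + N)) \<le> (\<Sum>k. f (R (k + N)))"
        using csa disj by (auto simp: countably_subadditive_def)
      also have "(\<Sum>k. f (R (k + N))) = ennreal (\<Sum>k. r (k + N))"
        unfolding r(1) using summ by (intro suminf_ennreal2) (auto simp: r(2) summable_iff_shift)
      also have "\<dots> \<le> ennreal e"
        using N[of N] by (intro ennreal_leI) auto
      finally have "f (X \<inter> C) + f (X - C) \<le> f (X \<inter> C) + (f (D N) + ennreal e)"
        by (simp add: add_left_mono)
      also have "\<dots> = (f (X \<inter> C) + f (D N)) + ennreal e"
        by (simp add: add.assoc)
      also have "f (X \<inter> C) + f (D N) \<le> f (X \<inter> C \<union> D N)"
      proof (rule sep)
        show "0 < 1 / real (Suc N)" by simp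
        fix x y assume "x \<in> X \<inter> C" "y \<in> D N"
        then show "1 / real (Suc N) \<le> dist x y"
          using infdist_le[of x C y] by (auto simp: D_def dist_commute)
      qed
      also have "\<dots> \<le> f X"
        by (rule mono) (auto simp: D_def)
      finally show "f (X \<inter> C) + f (X - C) \<le> f X + ennreal e"
        by (simp add: add_right_mono)
    qed
  qed
qed

text \<open>On the sets that split every set additively \<open>f\<close> is a measure, by
  Caratheodory. These sets form a sigma-algebra, which contains the closed sets by the previous
  lemma and hence all Borel sets.\<close>

lemma metric_outer_measure_borel:
  fixes f :: "'a::metric_space set \<Rightarrow> ennreal"
  assumes oms: "outer_measure_space UNIV f"
    and sep: "\<And>S T e. 0 < e \<Longrightarrow> (\<And>x y. x \<in> S \<Longrightarrow> y \<in> T \<Longrightarrow> e \<le> dist x y) \<Longrightarrow>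
      f S + f T \<le> f (S \<union> T)"
  shows "measure_space UNIV (sets borel) f"
proof -
  interpret sigma_algebra "UNIV :: 'a set" UNIV
    by (metis Pow_UNIV sigma_algebra_Pow)
  let ?L = "lambda_system UNIV UNIV f"
  have L: "measure_space UNIV ?L f"
    by (rule caratheodory_lemma[OF oms])
  then interpret L: sigma_algebra UNIV ?L
    by (simp add: measure_space_def)
  have "C \<in> ?L" if "closed C" for C
  proof -
    have "f (X \<inter> C) + f (X - C) = f X" for X
    proof (rule antisym)
      show "f (X \<inter> C) + f (X - C) \<le> f X"
        by (rule metric_outer_measure_closed[OF oms _ that]) (rule sep)
      have "subadditive UNIV f"
        using countably_subadditive_subadditive oms by (auto simp: outer_measure_space_def)
      moreover have "(X \<inter> C) \<inter> (X - C) = {}" "(X \<inter> C) \<union> (X - C) = X"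
        by auto
      ultimately show "f X \<le> f (X \<inter> C) + f (X - C)"
        unfolding subadditive_def by (metis UNIV_I)
    qed
    then show ?thesis by (simp add: lambda_system_eq)
  qed
  then have "sets borel \<subseteq> ?L"
    unfolding borel_eq_closed using L.sigma_sets_subset[of "Collect closed"] by auto
  then show ?thesis
    using L sets.sigma_algebra_axioms[of "borel :: 'a measure"]
    by (auto simp: measure_space_def positive_def countably_additive_def)
qed

section \<open>Hausdorff measure\<close>

definition hausdorff_cost :: "nat \<Rightarrow> 'a::euclidean_space set \<Rightarrow> ennreal" where
  "hausdorff_cost n E =
     (if E = {} then 0 else ennreal (unit_ball_vol (real n) * (diameter E / 2) ^ n))"

definition hausdorff_covers :: "real \<Rightarrow> 'a::euclidean_space set \<Rightarrow> (nat \<Rightarrow> 'a set) set" where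
  "hausdorff_covers \<delta> S = {E. S \<subseteq> (\<Union>k. E k) \<and> (\<forall>k. bounded (E k) \<and> diameter (E k) \<le> \<delta>)}"

text \<open>The inner infimum of \<open>hausdorff_measure\<close>. Estimates are made at a fixed
  scale \<delta> and passed to the supremum afterwards.\<close>

definition hausdorff_content :: "nat \<Rightarrow> real \<Rightarrow> 'a::euclidean_space set \<Rightarrow> ennreal" where
  "hausdorff_content n \<delta> S = (INF E\<in>hausdorff_covers \<delta> S. \<Sum>k. hausdorff_cost n (E k))"

lemma hausdorff_measure_content:
  "hausdorff_measure n S = (SUP \<delta>\<in>{0<..}. hausdorff_content n \<delta> S)"
  unfolding hausdorff_measure_def hausdorff_content_def hausdorff_covers_def hausdorff_cost_def ..

lemma hausdorff_content_le_cover: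
  "E \<in> hausdorff_covers \<delta> S \<Longrightarrow> hausdorff_content n \<delta> S \<le> (\<Sum>k. hausdorff_cost n (E k))"
  unfolding hausdorff_content_def by (rule INF_lower)

lemma hausdorff_content_le_measure:
  "0 < \<delta> \<Longrightarrow> hausdorff_content n \<delta> S \<le> hausdorff_measure n S"
  unfolding hausdorff_measure_content by (rule SUP_upper) simp

lemma hausdorff_measure_le:
  "(\<And>\<delta>. 0 < \<delta> \<Longrightarrow> hausdorff_content n \<delta> S \<le> c) \<Longrightarrow> hausdorff_measure n S \<le> c"
  unfolding hausdorff_measure_content by (rule SUP_least) simp

lemma hausdorff_content_antimono:
  "\<delta> \<le> \<delta>' \<Longrightarrow> hausdorff_content n \<delta>' S \<le> hausdorff_content n \<delta> S"
  unfolding hausdorff_content_def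
  by (rule INF_superset_mono) (auto simp: hausdorff_covers_def intro: order_trans)

text \<open>The image of a cover is a cover by sets of no larger diameter.\<close>

lemma hausdorff_content_lipschitz:
  fixes f :: "'a::euclidean_space \<Rightarrow> 'b::euclidean_space"
  assumes "\<And>x y. x \<in> S \<Longrightarrow> y \<in> S \<Longrightarrow> dist (f x) (f y) \<le> dist x y"
  shows "hausdorff_content n \<delta> (f ` S) \<le> hausdorff_content n \<delta> S"
  unfolding hausdorff_content_def[of n \<delta> S]
proof (rule INF_greatest)
  fix E assume E: "E \<in> hausdorff_covers \<delta> S"
  \<comment> \<open>The members are cut down to \<open>S\<close> because \<open>f\<close> is
    nonexpanding only there.\<close>
  let ?E = "\<lambda>k. f ` (E k \<inter> S)"
  have *: "bounded (?E k) \<and> diameter (?E k) \<le> diameter (E k)" for k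
  proof (cases "E k \<inter> S = {}")
    case True
    then show ?thesis using E by (auto simp: hausdorff_covers_def intro!: diameter_ge_0)
  next
    case False
    have bd: "dist (f x) (f y) \<le> diameter (E k)" if "x \<in> E k \<inter> S" "y \<in> E k \<inter> S" for x y
      using that E assms[of x y] diameter_bounded_bound[of "E k" x y]
      by (force simp: hausdorff_covers_def)
    then have "bounded (?E k)"
      using False unfolding bounded_def by blast
    moreover have "diameter (?E k) \<le> diameter (E k)"
      using False bd by (intro diameter_le) (auto simp: dist_norm)
    ultimately show ?thesis ..
  qed
  have "?E \<in> hausdorff_covers \<delta> (f ` S)"
  proof -
    have "f ` S \<subseteq> (\<Union>k. ?E k)" using E by (force simp: hausdorff_covers_def)
    moreover have "diameter (?E k) \<le> \<delta>" for k
      using * E order_trans unfolding hausdorff_covers_def by blast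
    ultimately show ?thesis using * by (simp add: hausdorff_covers_def)
  qed
  then have "hausdorff_content n \<delta> (f ` S) \<le> (\<Sum>k. hausdorff_cost n (?E k))"
    by (rule hausdorff_content_le_cover)
  also have "\<dots> \<le> (\<Sum>k. hausdorff_cost n (E k))"
  proof (intro suminf_le summableI)
    fix k
    have "0 \<le> diameter (?E k)" using * by (auto intro: diameter_ge_0)
    then show "hausdorff_cost n (?E k) \<le> hausdorff_cost n (E k)"
      using *[of k] by (auto simp: hausdorff_cost_def intro!: ennreal_leI mult_left_mono power_mono)
  qed
  finally show "hausdorff_content n \<delta> (f ` S) \<le> (\<Sum>k. hausdorff_cost n (E k))" .
qed

lemma hausdorff_measure_lipschitz:
  fixes f :: "'a::euclidean_space \<Rightarrow> 'b::euclidean_space"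
  assumes "\<And>x y. x \<in> S \<Longrightarrow> y \<in> S \<Longrightarrow> dist (f x) (f y) \<le> dist x y"
  shows "hausdorff_measure n (f ` S) \<le> hausdorff_measure n S"
  by (rule hausdorff_measure_le)
    (meson assms hausdorff_content_lipschitz hausdorff_content_le_measure order_trans)

lemma hausdorff_content_mono:
  "S \<subseteq> T \<Longrightarrow> hausdorff_content n \<delta> S \<le> hausdorff_content n \<delta> T"
  unfolding hausdorff_content_def
  by (rule INF_superset_mono) (auto simp: hausdorff_covers_def)

lemma hausdorff_measure_mono:
  "S \<subseteq> T \<Longrightarrow> hausdorff_measure n S \<le> hausdorff_measure n T"
  unfolding hausdorff_measure_content by (intro SUP_mono) (auto intro: hausdorff_content_mono)

lemma hausdorff_measure_translation:
  "hausdorff_measure n ((\<lambda>x. x + v) ` S) = hausdorff_measure n S"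
proof (rule antisym)
  show "hausdorff_measure n ((\<lambda>x. x + v) ` S) \<le> hausdorff_measure n S"
    by (rule hausdorff_measure_lipschitz) simp
  have "hausdorff_measure n ((\<lambda>x. x - v) ` (\<lambda>x. x + v) ` S) \<le> hausdorff_measure n ((\<lambda>x. x + v) ` S)"
    by (rule hausdorff_measure_lipschitz) (simp add: dist_norm)
  then show "hausdorff_measure n S \<le> hausdorff_measure n ((\<lambda>x. x + v) ` S)"
    by (simp add: image_image)
qed

text \<open>Covers of the \<open>A i\<close> that are optimal up to \<open>e / 2 ^ (i + 1)\<close>
  are merged into one sequence by the pairing function; the errors add up to
  \<open>e\<close>.\<close>

lemma hausdorff_content_countably_subadditive:
  "hausdorff_content n \<delta> (\<Union>i::nat. A i) \<le> (\<Sum>i. hausdorff_content n \<delta> (A i))"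
proof (rule ennreal_le_epsilon)
  fix e :: real assume e: "0 < e" "(\<Sum>i. hausdorff_content n \<delta> (A i)) < top"
  have "\<exists>E\<in>hausdorff_covers \<delta> (A i).
      (\<Sum>k. hausdorff_cost n (E k)) < hausdorff_content n \<delta> (A i) + e * (1/2) ^ Suc i" for i
  proof (rule INF_approx_ennreal)
    show "0 < e * (1/2) ^ Suc i" using e by simp
    show "hausdorff_content n \<delta> (A i) \<noteq> \<infinity>"
      using ennreal_suminf_lessD[OF e(2)] by (metis infinity_ennreal_def order_less_irrefl)
  qed (rule hausdorff_content_def)
  then obtain E where E: "\<And>i. E i \<in> hausdorff_covers \<delta> (A i)"
    "\<And>i. (\<Sum>k. hausdorff_cost n (E i k)) \<le> hausdorff_content n \<delta> (A i) + e * (1/2) ^ Suc i"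
    by (metis less_imp_le)
  define F where "F m = (case prod_decode m of (i, k) \<Rightarrow> E i k)" for m
  have "(\<Union>i. A i) \<subseteq> (\<Union>m. F m)"
  proof
    fix x assume "x \<in> (\<Union>i. A i)"
    then obtain i k where "x \<in> E i k" using E(1) by (force simp: hausdorff_covers_def)
    then have "x \<in> F (prod_encode (i, k))" by (simp add: F_def)
    then show "x \<in> (\<Union>m. F m)" by blast
  qed
  then have "F \<in> hausdorff_covers \<delta> (\<Union>i. A i)"
    using E(1) by (auto simp: hausdorff_covers_def F_def split: prod.split)
  then have "hausdorff_content n \<delta> (\<Union>i. A i) \<le> (\<Sum>m. hausdorff_cost n (F m))"
    by (rule hausdorff_content_le_cover)
  also have "\<dots> = (\<Sum>m. (\<lambda>(i, k). hausdorff_cost n (E i k)) (prod_decode m))"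
    by (simp add: F_def case_prod_beta)
  also have "\<dots> = (\<Sum>i. \<Sum>k. hausdorff_cost n (E i k))"
    by (rule suminf_ennreal_2dimen) simp
  also have "\<dots> \<le> (\<Sum>i. hausdorff_content n \<delta> (A i) + e * (1/2) ^ Suc i)"
    by (intro suminf_le summableI E)
  also have "\<dots> = (\<Sum>i. hausdorff_content n \<delta> (A i)) + (\<Sum>i. ennreal e * ennreal ((1/2) ^ Suc i))"
    using e(1) by (subst suminf_add[symmetric])
      (auto simp del: ennreal_suminf_cmult simp add: ennreal_mult[symmetric])
  also have "\<dots> = (\<Sum>i. hausdorff_content n \<delta> (A i)) + e"
    unfolding ennreal_suminf_cmult
    by (subst suminf_ennreal_eq[OF zero_le_power power_half_series]) auto
  finally show "hausdorff_content n \<delta> (\<Union>i. A i) \<le> (\<Sum>i. hausdorff_content n \<delta> (A i)) + e" .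
qed

lemma hausdorff_measure_countably_subadditive:
  "hausdorff_measure n (\<Union>i::nat. A i) \<le> (\<Sum>i. hausdorff_measure n (A i))"
proof (rule hausdorff_measure_le)
  fix \<delta> :: real assume "0 < \<delta>"
  then have "(\<Sum>i. hausdorff_content n \<delta> (A i)) \<le> (\<Sum>i. hausdorff_measure n (A i))"
    by (intro suminf_le summableI hausdorff_content_le_measure)
  then show "hausdorff_content n \<delta> (\<Union>i. A i) \<le> (\<Sum>i. hausdorff_measure n (A i))"
    using hausdorff_content_countably_subadditive order_trans by blast
qed

lemma hausdorff_measure_empty [simp]: "hausdorff_measure n {} = 0"
proof -
  have "hausdorff_measure n {} \<le> 0"
  proof (rule hausdorff_measure_le)
    fix \<delta> :: real assume "0 < \<delta>"
    then have "(\<lambda>_. {}) \<in> hausdorff_covers \<delta> {}" by (simp add: hausdorff_covers_def)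
    from hausdorff_content_le_cover[OF this] show "hausdorff_content n \<delta> {} \<le> 0"
      by (simp add: hausdorff_cost_def)
  qed
  then show ?thesis by simp
qed

lemma outer_measure_space_hausdorff: "outer_measure_space UNIV (hausdorff_measure n)"
  unfolding outer_measure_space_def positive_def increasing_def countably_subadditive_def
  using hausdorff_measure_mono hausdorff_measure_countably_subadditive by auto

text \<open>A set of diameter at most \<delta> cannot meet both \<open>S\<close> and
  \<open>T\<close>, so each cover of the union splits into a cover of \<open>S\<close> and a cover
  of \<open>T\<close>.\<close>

lemma hausdorff_content_separated:
  assumes sep: "\<And>x y. x \<in> S \<Longrightarrow> y \<in> T \<Longrightarrow> \<delta> < dist x y"
  shows "hausdorff_content n \<delta> S + hausdorff_content n \<delta> T \<le> hausdorff_content n \<delta> (S \<union> T)"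
  unfolding hausdorff_content_def[of n \<delta> "S \<union> T"]
proof (rule INF_greatest)
  fix E assume E: "E \<in> hausdorff_covers \<delta> (S \<union> T)"
  \<comment> \<open>Members that miss \<open>U\<close> are replaced by the empty set, which costs
    nothing. Its diameter 0 is admissible because the existence of the cover \<open>E\<close> forces
    \<delta> to be nonnegative.\<close>
  define P where "P U k = (if E k \<inter> U = {} then {} else E k)" for U k
  have nonneg: "0 \<le> \<delta>"
    using E by (auto simp: hausdorff_covers_def intro: order_trans[OF diameter_ge_0])
  have P: "P U \<in> hausdorff_covers \<delta> U" if U: "U \<subseteq> S \<union> T" for U
  proof -
    have "U \<subseteq> (\<Union>k. P U k)"
    proof
      fix x assume "x \<in> U"
      then obtain k where "x \<in> E k" using E U \<open>x \<in> U\<close> unfolding hausdorff_covers_def by blast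
      then have "x \<in> P U k" using \<open>x \<in> U\<close> by (auto simp: P_def)
      then show "x \<in> (\<Union>k. P U k)" by blast
    qed
    then show ?thesis
      using E nonneg by (auto simp: hausdorff_covers_def P_def)
  qed
  have "hausdorff_content n \<delta> S + hausdorff_content n \<delta> T
      \<le> (\<Sum>k. hausdorff_cost n (P S k)) + (\<Sum>k. hausdorff_cost n (P T k))"
    by (intro add_mono hausdorff_content_le_cover P) auto
  also have "\<dots> = (\<Sum>k. hausdorff_cost n (P S k) + hausdorff_cost n (P T k))"
    by (intro suminf_add summableI)
  also have "\<dots> \<le> (\<Sum>k. hausdorff_cost n (E k))"
  proof (intro suminf_le summableI)
    fix k
    have "E k \<inter> S = {} \<or> E k \<inter> T = {}"
    proof (rule ccontr)
      assume "\<not> ?thesis"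
      then obtain x y where xy: "x \<in> E k" "x \<in> S" "y \<in> E k" "y \<in> T" by blast
      have "bounded (E k)" "diameter (E k) \<le> \<delta>"
        using E by (auto simp: hausdorff_covers_def)
      then have "dist x y \<le> \<delta>"
        using diameter_bounded_bound[of "E k" x y] xy by simp
      then show False
        using sep[OF xy(2,4)] by simp
    qed
    then show "hausdorff_cost n (P S k) + hausdorff_cost n (P T k) \<le> hausdorff_cost n (E k)"
      by (auto simp: P_def hausdorff_cost_def)
  qed
  finally show "hausdorff_content n \<delta> S + hausdorff_content n \<delta> T \<le> (\<Sum>k. hausdorff_cost n (E k))" .
qed

lemma hausdorff_measure_separated:
  assumes "0 < e" and sep: "\<And>x y. x \<in> S \<Longrightarrow> y \<in> T \<Longrightarrow> e \<le> dist x y"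
  shows "hausdorff_measure n S + hausdorff_measure n T \<le> hausdorff_measure n (S \<union> T)"
proof -
  \<comment> \<open>The scales are independent, since the suprema in the two summands are taken one
    after the other. Both contents are compared at a common scale \<open>m\<close> smaller than the
    gap \<open>e\<close>.\<close>
  have "hausdorff_content n \<delta> S + hausdorff_content n \<delta>' T \<le> hausdorff_measure n (S \<union> T)"
    if "0 < \<delta>" "0 < \<delta>'" for \<delta> \<delta>'
  proof -
    define m where "m = Min {\<delta>, \<delta>', e / 2}"
    have m: "m \<le> \<delta>" "m \<le> \<delta>'" "0 < m" "m < e"
      using that assms by (auto simp: m_def min_def)
    have "hausdorff_content n \<delta> S + hausdorff_content n \<delta>' T
        \<le> hausdorff_content n m S + hausdorff_content n m T"
      using m by (intro add_mono hausdorff_content_antimono)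
    also have "\<dots> \<le> hausdorff_content n m (S \<union> T)"
      using m sep by (intro hausdorff_content_separated) force
    also have "\<dots> \<le> hausdorff_measure n (S \<union> T)"
      using m by (intro hausdorff_content_le_measure)
    finally show ?thesis .
  qed
  then have "hausdorff_content n \<delta> S + hausdorff_measure n T \<le> hausdorff_measure n (S \<union> T)"
    if "0 < \<delta>" for \<delta>
    unfolding hausdorff_measure_content[of n T] using that
    by (subst ennreal_SUP_add_right) (auto intro!: SUP_least)
  then show ?thesis
    unfolding hausdorff_measure_content[of n S]
    by (subst ennreal_SUP_add_left[symmetric]) (auto intro!: SUP_least)
qed

section \<open>Finiteness on bounded subsets of a subspace\<close>

lemma hausdorff_content_le_finite_cover:
  assumes "finite I" "S \<subseteq> (\<Union>i\<in>I. A i)" "0 \<le> \<delta>"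
    and A: "\<And>i. i \<in> I \<Longrightarrow> bounded (A i)" "\<And>i. i \<in> I \<Longrightarrow> diameter (A i) \<le> \<delta>"
  shows "hausdorff_content n \<delta> S \<le> of_nat (card I) * ennreal (unit_ball_vol (real n) * (\<delta> / 2) ^ n)"
proof -
  obtain h where h: "bij_betw h {0..<card I} I"
    using ex_bij_betw_nat_finite[OF \<open>finite I\<close>] by blast
  define E where "E k = (if k < card I then A (h k) else {})" for k
  have hI: "h k \<in> I" if "k < card I" for k
    using bij_betwE[OF h] that by simp
  have "S \<subseteq> (\<Union>k. E k)"
  proof
    fix x assume "x \<in> S"
    then obtain i where "i \<in> I" "x \<in> A i" using assms by blast
    then obtain k where "k < card I" "x \<in> A (h k)"
      using h unfolding bij_betw_def by (metis atLeastLessThan_iff imageE)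
    then have "x \<in> E k" by (simp add: E_def)
    then show "x \<in> (\<Union>k. E k)" by blast
  qed
  then have "E \<in> hausdorff_covers \<delta> S"
    using A hI \<open>0 \<le> \<delta>\<close> by (simp add: hausdorff_covers_def E_def)
  then have "hausdorff_content n \<delta> S \<le> (\<Sum>k. hausdorff_cost n (E k))"
    by (rule hausdorff_content_le_cover)
  also have "\<dots> = (\<Sum>k<card I. hausdorff_cost n (E k))"
    by (rule suminf_finite) (auto simp: E_def hausdorff_cost_def)
  also have "\<dots> \<le> (\<Sum>k<card I. ennreal (unit_ball_vol (real n) * (\<delta> / 2) ^ n))"
  proof (rule sum_mono)
    fix k assume "k \<in> {..<card I}"
    then have "bounded (E k)" "diameter (E k) \<le> \<delta>"
      using A hI by (auto simp: E_def)
    then show "hausdorff_cost n (E k) \<le> ennreal (unit_ball_vol (real n) * (\<delta> / 2) ^ n)"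
      using diameter_ge_0[of "E k"]
      by (auto simp: hausdorff_cost_def intro!: ennreal_leI mult_left_mono power_mono)
  qed
  finally show ?thesis by simp
qed

text \<open>In orthonormal coordinates of \<open>V\<close> the set lies in a cube of side
  \<open>2 * R\<close>. A grid of mesh \<open>s\<close> covers it by \<open>(m + 1) ^ n\<close>
  cells of diameter at most \<open>n * s\<close>, and since \<open>s\<close> is proportional to
  \<open>1 / m\<close>, the total cost is bounded independently of \<open>m\<close>.\<close>

lemma hausdorff_measure_bounded_subspace:
  fixes V :: "'a::euclidean_space set"
  assumes "subspace V" "S \<subseteq> V" "bounded S"
  shows "hausdorff_measure (dim V) S < top"
proof -
  obtain B where orth: "pairwise orthogonal B" "\<And>b. b \<in> B \<Longrightarrow> norm b = 1"
    and "independent B" and card: "card B = dim V" and span: "span B = V"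
    using orthonormal_basis_subspace[OF \<open>subspace V\<close>] by metis
  then have fin: "finite B"
    using independent_imp_finite by blast
  define n where "n = dim V"
  obtain R where "0 < R" and R: "\<And>x. x \<in> S \<Longrightarrow> norm x \<le> R"
    using \<open>bounded S\<close> bounded_pos by metis
  define K where "K = unit_ball_vol (real n) * (2 * R * n) ^ n"
  have "hausdorff_content n \<delta> S \<le> ennreal K" if "0 < \<delta>" for \<delta>
  proof -
    \<comment> \<open>The second bound on \<open>m\<close> gives
      \<open>n * s \<le> \<delta>\<close>; the first gives \<open>(m + 1) / m \<le> 2\<close>, the
      source of the factor 2 in \<open>K\<close>.\<close>
    obtain m :: nat where m: "max 1 (2 * R * n / \<delta>) < real m"
      using reals_Archimedean2 by blast
    define s where "s = 2 * R / m"
    have "0 < s" using m \<open>0 < R\<close> by (simp add: s_def)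
    have "n * s \<le> \<delta>"
      using m \<open>0 < \<delta>\<close> by (simp add: s_def field_simps)
    \<comment> \<open>There are \<open>m + 1\<close> indices in each direction, not
      \<open>m\<close>: a coordinate with \<open>x \<bullet> b + R = 2 * R\<close> has index
      \<open>m\<close>.\<close>
    define I where "I = (B \<rightarrow>\<^sub>E {..m})"
    define A where "A g = {x\<in>V. \<forall>b\<in>B. real (g b) * s \<le> x \<bullet> b + R \<and> x \<bullet> b + R \<le> (real (g b) + 1) * s}" for g
    have dist: "norm (x - y) \<le> n * s" if "x \<in> A g" "y \<in> A g" for x y g
    proof -
      have "x - y \<in> span B"
        using that span \<open>subspace V\<close> by (auto simp: A_def intro: subspace_diff)
      then have "norm (x - y) = norm (\<Sum>b\<in>B. ((x - y) \<bullet> b) *\<^sub>R b)"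
        using orthonormal_basis_expand[OF orth _ fin] by simp
      also have "\<dots> \<le> (\<Sum>b\<in>B. norm (((x - y) \<bullet> b) *\<^sub>R b))"
        by (rule norm_sum)
      also have "\<dots> \<le> (\<Sum>b\<in>B. s)"
      proof (rule sum_mono)
        fix b assume "b \<in> B"
        then have "x \<bullet> b - y \<bullet> b \<le> s" "y \<bullet> b - x \<bullet> b \<le> s"
          using that by (force simp: A_def algebra_simps)+
        then show "norm (((x - y) \<bullet> b) *\<^sub>R b) \<le> s"
          using orth(2) \<open>b \<in> B\<close> by (simp add: inner_diff_left abs_le_iff)
      qed
      finally show ?thesis by (simp add: card n_def)
    qed
    have "S \<subseteq> (\<Union>g\<in>I. A g)"
    proof
      fix x assume "x \<in> S"
      define g where "g = (\<lambda>b\<in>B. nat \<lfloor>(x \<bullet> b + R) / s\<rfloor>)"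
      have bd: "0 \<le> x \<bullet> b + R" "x \<bullet> b + R \<le> 2 * R" if "b \<in> B" for b
        using Cauchy_Schwarz_ineq2[of x b] orth(2)[OF that] R[OF \<open>x \<in> S\<close>] by auto
      have "g \<in> I"
        unfolding I_def
      proof (rule PiE_I)
        fix b assume "b \<in> B"
        have "(x \<bullet> b + R) / s \<le> 2 * R / s"
          using bd[OF \<open>b \<in> B\<close>] \<open>0 < s\<close> by (intro divide_right_mono) auto
        also have "\<dots> = real m"
          using \<open>0 < R\<close> m by (simp add: s_def)
        finally have "\<lfloor>(x \<bullet> b + R) / s\<rfloor> \<le> int m" by (simp add: floor_le_iff)
        then show "g b \<in> {..m}" using \<open>b \<in> B\<close> by (simp add: g_def)
      qed (simp add: g_def)
      moreover have "x \<in> A g"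
      proof -
        have "real (g b) * s \<le> x \<bullet> b + R \<and> x \<bullet> b + R \<le> (real (g b) + 1) * s" if "b \<in> B" for b
        proof -
          have "real (g b) = of_int \<lfloor>(x \<bullet> b + R) / s\<rfloor>"
            using that bd \<open>0 < s\<close> by (simp add: g_def)
          then have "real (g b) \<le> (x \<bullet> b + R) / s" "(x \<bullet> b + R) / s \<le> real (g b) + 1"
            by linarith+
          then show ?thesis using \<open>0 < s\<close> by (simp add: field_simps)
        qed
        then show ?thesis using \<open>x \<in> S\<close> \<open>S \<subseteq> V\<close> by (auto simp: A_def)
      qed
      ultimately show "x \<in> (\<Union>g\<in>I. A g)" by blast
    qed
    moreover have "bounded (A g)" for g
      using dist unfolding bounded_def dist_norm by blast
    moreover have "diameter (A g) \<le> n * s" for g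
      using dist \<open>0 < s\<close> by (intro diameter_le) auto
    moreover have "finite I" using fin by (simp add: I_def finite_PiE)
    ultimately have "hausdorff_content n (n * s) S
        \<le> of_nat (card I) * ennreal (unit_ball_vol (real n) * (n * s / 2) ^ n)"
      using \<open>0 < s\<close> by (intro hausdorff_content_le_finite_cover) auto
    also have "card I = (m + 1) ^ n"
      using fin by (simp add: I_def card_PiE card n_def)
    also have "of_nat ((m + 1) ^ n) * ennreal (unit_ball_vol (real n) * (n * s / 2) ^ n)
        = ennreal (real ((m + 1) ^ n) * (unit_ball_vol (real n) * (n * s / 2) ^ n))"
      using \<open>0 < s\<close>
      by (subst ennreal_mult) (auto simp: ennreal_of_nat_eq_real_of_nat simp del: of_nat_power)
    also have "real ((m + 1) ^ n) * (unit_ball_vol (real n) * (n * s / 2) ^ n)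
        = unit_ball_vol (real n) * ((m + 1) * (n * s / 2)) ^ n"
      by (simp only: power_mult_distrib of_nat_power of_nat_add of_nat_1 mult_ac)
    also have "ennreal \<dots> \<le> ennreal K"
    proof -
      have "(m + 1) * (n * s / 2) = R * n * ((m + 1) / m)"
        by (simp add: s_def field_simps)
      also have "\<dots> \<le> R * n * 2"
        using m \<open>0 < R\<close> by (intro mult_left_mono) (auto simp: field_simps)
      finally have "(m + 1) * (n * s / 2) \<le> 2 * R * n" by simp
      then show ?thesis
        using \<open>0 < s\<close> unfolding K_def by (intro ennreal_leI mult_left_mono power_mono) auto
    qed
    finally have "hausdorff_content n (n * s) S \<le> ennreal K" .
    then show ?thesis
      using hausdorff_content_antimono[OF \<open>n * s \<le> \<delta>\<close>] order_trans by blast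
  qed
  then have "hausdorff_measure n S \<le> ennreal K" by (rule hausdorff_measure_le)
  then show ?thesis by (simp add: n_def[symmetric] le_less_trans)
qed

section \<open>Hausdorff measure on a subspace as a Borel measure\<close>

definition hausdorff :: "nat \<Rightarrow> 'a::euclidean_space measure" where
  "hausdorff n = measure_of UNIV (sets borel) (hausdorff_measure n)"

lemma space_hausdorff [simp]: "space (hausdorff n) = UNIV"
  by (simp add: hausdorff_def space_measure_of_conv)

lemma sets_hausdorff [simp, measurable_cong]: "sets (hausdorff n) = sets borel"
  using sets.sigma_sets_eq[of borel] by (simp add: hausdorff_def)

lemma measure_space_hausdorff: "measure_space UNIV (sets borel) (hausdorff_measure n)"
  by (rule metric_outer_measure_borel[OF outer_measure_space_hausdorff])
    (rule hausdorff_measure_separated)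

lemma emeasure_hausdorff: "A \<in> sets borel \<Longrightarrow> emeasure (hausdorff n) A = hausdorff_measure n A"
  using measure_space_hausdorff unfolding hausdorff_def measure_space_def
  by (intro emeasure_measure_of_sigma) auto

text \<open>A density instead of a restricted space keeps \<open>UNIV\<close> as the underlying
  space, so that maps of the whole space can be pushed forward.\<close>

definition subspace_measure :: "'a::euclidean_space set \<Rightarrow> 'a measure" where
  "subspace_measure V = density (hausdorff (dim V)) (indicator V)"

lemma space_subspace_measure [simp]: "space (subspace_measure V) = UNIV"
  by (simp add: subspace_measure_def)

lemma sets_subspace_measure [simp, measurable_cong]: "sets (subspace_measure V) = sets borel"
  by (simp add: subspace_measure_def)

lemma emeasure_subspace_measure:
  assumes "subspace V" "A \<in> sets borel"
  shows "emeasure (subspace_measure V) A = hausdorff_measure (dim V) (V \<inter> A)"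
proof -
  have V: "V \<in> sets borel" using assms(1) by (intro borel_closed closed_subspace)
  then show ?thesis
    using assms emeasure_hausdorff[of "V \<inter> A" "dim V"]
    by (simp add: subspace_measure_def emeasure_restricted)
qed

lemma sigma_finite_subspace_measure:
  fixes V :: "'a::euclidean_space set"
  assumes "subspace V"
  shows "sigma_finite_measure (subspace_measure V)"
proof
  let ?A = "range (\<lambda>n::nat. cball (0::'a) (real n))"
  have "emeasure (subspace_measure V) (cball 0 r) \<noteq> \<infinity>" for r
    using hausdorff_measure_bounded_subspace[OF assms, of "V \<inter> cball 0 r"]
    by (simp add: emeasure_subspace_measure assms bounded_Int)
  moreover have "\<exists>n. x \<in> cball 0 (real n)" for x :: 'a
    using real_arch_simple[of "norm x"] by simp
  then have "\<Union>?A = UNIV" by blast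
  ultimately show "\<exists>A. countable A \<and> A \<subseteq> sets (subspace_measure V) \<and>
      \<Union>A = space (subspace_measure V) \<and> (\<forall>a\<in>A. emeasure (subspace_measure V) a \<noteq> \<infinity>)"
    by (intro exI[of _ ?A]) auto
qed

lemma distr_translation_subspace_measure:
  fixes V :: "'a::euclidean_space set"
  assumes V: "subspace V" and v: "v \<in> V"
  shows "distr (subspace_measure V) borel (\<lambda>x. x + v) = subspace_measure V"
proof (rule measure_eqI)
  fix A :: "'a set" assume "A \<in> sets (distr (subspace_measure V) borel (\<lambda>x. x + v))"
  then have A: "A \<in> sets borel" by simp
  have "(\<lambda>x. x + v) ` (V \<inter> (\<lambda>x. x + v) -` A) = V \<inter> A"
  proof (intro equalityI subsetI)
    fix y assume "y \<in> V \<inter> A"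
    then have "y - v \<in> V \<inter> (\<lambda>x. x + v) -` A" "y = (y - v) + v"
      using V v by (auto intro: subspace_diff)
    then show "y \<in> (\<lambda>x. x + v) ` (V \<inter> (\<lambda>x. x + v) -` A)" by blast
  qed (use V v in \<open>auto intro: subspace_add\<close>)
  then have "hausdorff_measure (dim V) (V \<inter> A)
      = hausdorff_measure (dim V) (V \<inter> (\<lambda>x. x + v) -` A)"
    using hausdorff_measure_translation by metis
  moreover have "(\<lambda>x. x + v) -` A \<in> sets borel"
    using measurable_sets[OF _ A, of "\<lambda>x. x + v" borel] by simp
  ultimately show "emeasure (distr (subspace_measure V) borel (\<lambda>x. x + v)) A
      = emeasure (subspace_measure V) A"
    using A V by (simp add: emeasure_distr emeasure_subspace_measure)
qed simp

section \<open>Invariance under shears\<close>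

text \<open>
  Averaging over the translations by \<open>t b\<close> with \<open>t \<in> [0, 1]\<close>, Tonelli's theorem turns the shear,
  for each fixed point, into a translation of the parameter \<open>t\<close>.
\<close>

lemma distr_shear:
  fixes M :: "'a::euclidean_space measure"
  assumes sets [measurable_cong, simp]: "sets M = sets borel" and "sigma_finite_measure M"
    and inv: "\<And>t. distr M borel (\<lambda>x. x + t *\<^sub>R b) = M"
    and \<gamma> [measurable]: "\<gamma> \<in> borel_measurable borel"
    and \<gamma>_inv: "\<And>x t. \<gamma> (x + t *\<^sub>R b) = \<gamma> x"
  shows "distr M borel (\<lambda>x. x + \<gamma> x *\<^sub>R b) = M"
proof (rule measure_eqI)
  interpret M: sigma_finite_measure M by fact
  interpret P: pair_sigma_finite lborel M ..
  fix A :: "'a set" assume "A \<in> sets (distr M borel (\<lambda>x. x + \<gamma> x *\<^sub>R b))"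
  then have A [measurable]: "A \<in> sets borel" by simp
  have sp: "space M = UNIV" using sets_eq_imp_space_eq[OF sets] by simp
  have inv_int: "(\<integral>\<^sup>+x. f (x + t *\<^sub>R b) \<partial>M) = (\<integral>\<^sup>+x. f x \<partial>M)"
    if [measurable]: "f \<in> borel_measurable borel" for f :: "'a \<Rightarrow> ennreal" and t
    by (subst (2) inv[of t, symmetric], subst nn_integral_distr) simp_all
  \<comment> \<open>The weight of the average over \<open>t\<close>; it matters only that its
    integral is 1.\<close>
  define J :: "real \<Rightarrow> ennreal" where "J = indicator {0..1}"
  have J [measurable]: "J \<in> borel_measurable borel" by (simp add: J_def)
  have J1: "(\<integral>\<^sup>+t. J t \<partial>lborel) = 1" by (simp add: J_def)
  have J_shift: "(\<integral>\<^sup>+t. J (t + c) * f (t + c) \<partial>lborel) = (\<integral>\<^sup>+t. J t * f t \<partial>lborel)"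
    if [measurable]: "f \<in> borel_measurable borel" for f c
    using nn_integral_real_affine[of "\<lambda>t. J t * f t" 1 c] by (simp add: add.commute)
  let ?I = "indicator A :: 'a \<Rightarrow> ennreal"
  let ?S = "\<lambda>x. x + \<gamma> x *\<^sub>R b"
  have "emeasure (distr M borel ?S) A = emeasure M (?S -` A)"
    by (simp add: emeasure_distr sp)
  also have "\<dots> = (\<integral>\<^sup>+x. ?I (?S x) \<partial>M)"
  proof -
    have "?S -` A \<in> sets M" using measurable_sets[OF _ A, of ?S M] sp by simp
    moreover have "(\<lambda>x. ?I (?S x)) = indicator (?S -` A)"
      by (simp add: fun_eq_iff indicator_def)
    ultimately show ?thesis by simp
  qed
  also have "\<dots> = (\<integral>\<^sup>+t. J t * (\<integral>\<^sup>+x. ?I (?S x) \<partial>M) \<partial>lborel)"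
    by (simp add: nn_integral_multc J1)
  also have "\<dots> = (\<integral>\<^sup>+t. (\<integral>\<^sup>+x. J t * ?I (x + (t + \<gamma> x) *\<^sub>R b) \<partial>M) \<partial>lborel)"
  proof (rule nn_integral_cong)
    fix t
    \<comment> \<open>Translating by \<open>t *\<^sub>R b\<close> does not change
      \<open>\<gamma> x\<close>, so the shear now enters only through the sum
      \<open>t + \<gamma> x\<close>.\<close>
    have "(\<integral>\<^sup>+x. ?I (?S x) \<partial>M) = (\<integral>\<^sup>+x. ?I (?S (x + t *\<^sub>R b)) \<partial>M)"
      by (subst inv_int) simp_all
    also have "\<dots> = (\<integral>\<^sup>+x. ?I (x + (t + \<gamma> x) *\<^sub>R b) \<partial>M)"
      by (simp add: \<gamma>_inv algebra_simps)
    finally show "J t * (\<integral>\<^sup>+x. ?I (?S x) \<partial>M) = (\<integral>\<^sup>+x. J t * ?I (x + (t + \<gamma> x) *\<^sub>R b) \<partial>M)"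
      by (simp add: nn_integral_cmult)
  qed
  also have "\<dots> = (\<integral>\<^sup>+x. (\<integral>\<^sup>+t. J t * ?I (x + (t + \<gamma> x) *\<^sub>R b) \<partial>lborel) \<partial>M)"
    by (rule P.Fubini'[symmetric]) measurable
  also have "\<dots> = (\<integral>\<^sup>+x. (\<integral>\<^sup>+t. J (t - \<gamma> x) * ?I (x + t *\<^sub>R b) \<partial>lborel) \<partial>M)"
  \<comment> \<open>For fixed \<open>x\<close> the number \<open>\<gamma> x\<close> is a constant:
    substituting \<open>t - \<gamma> x\<close> for \<open>t\<close> moves it from the point to the
    weight.\<close>
  proof (rule nn_integral_cong)
    fix x
    show "(\<integral>\<^sup>+t. J t * ?I (x + (t + \<gamma> x) *\<^sub>R b) \<partial>lborel)
        = (\<integral>\<^sup>+t. J (t - \<gamma> x) * ?I (x + t *\<^sub>R b) \<partial>lborel)"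
      using J_shift[of "\<lambda>t. ?I (x + (t + \<gamma> x) *\<^sub>R b)" "- \<gamma> x"] by simp
  qed
  also have "\<dots> = (\<integral>\<^sup>+t. (\<integral>\<^sup>+x. J (t - \<gamma> x) * ?I (x + t *\<^sub>R b) \<partial>M) \<partial>lborel)"
    by (rule P.Fubini') measurable
  also have "\<dots> = (\<integral>\<^sup>+t. (\<integral>\<^sup>+x. J (t - \<gamma> x) * ?I x \<partial>M) \<partial>lborel)"
  \<comment> \<open>For fixed \<open>t\<close> the translation is undone; the weight
    \<open>J (t - \<gamma> x)\<close> is unaffected because \<gamma> is constant along
    \<open>b\<close>. It then integrates to 1 in \<open>t\<close>.\<close>
  proof (rule nn_integral_cong)
    fix t
    show "(\<integral>\<^sup>+x. J (t - \<gamma> x) * ?I (x + t *\<^sub>R b) \<partial>M) = (\<integral>\<^sup>+x. J (t - \<gamma> x) * ?I x \<partial>M)"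
      using inv_int[of "\<lambda>x. J (t - \<gamma> x) * ?I x" t] by (simp add: \<gamma>_inv)
  qed
  also have "\<dots> = (\<integral>\<^sup>+x. (\<integral>\<^sup>+t. J (t - \<gamma> x) * ?I x \<partial>lborel) \<partial>M)"
    by (rule P.Fubini'[symmetric]) measurable
  also have "\<dots> = (\<integral>\<^sup>+x. ?I x \<partial>M)"
  proof (rule nn_integral_cong)
    fix x
    show "(\<integral>\<^sup>+t. J (t - \<gamma> x) * ?I x \<partial>lborel) = ?I x"
      using J_shift[of "\<lambda>_. 1" "- \<gamma> x"] by (simp add: nn_integral_multc J1)
  qed
  also have "\<dots> = emeasure M A" by simp
  finally show "emeasure (distr M borel ?S) A = emeasure M A" .
qed simp

text \<open>The map is a composition of shears along single vectors of \<open>B\<close>, composed in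
  order of decreasing degree. The coefficient \<open>\<gamma> b\<close> is invariant along all
  vectors of degree at least \<open>deg b\<close>, so it does not notice the shears applied
  before.\<close>

lemma distr_triangular_shear:
  fixes M :: "'a::euclidean_space measure" and deg :: "'a \<Rightarrow> nat" and \<gamma> :: "'a \<Rightarrow> 'a \<Rightarrow> real"
  assumes sets [measurable_cong, simp]: "sets M = sets borel" and "sigma_finite_measure M"
    and "finite B"
    and inv: "\<And>b t. b \<in> B \<Longrightarrow> distr M borel (\<lambda>x. x + t *\<^sub>R b) = M"
    and \<gamma>: "\<And>b. b \<in> B \<Longrightarrow> \<gamma> b \<in> borel_measurable borel"
    and \<gamma>_inv: "\<And>b c x t. b \<in> B \<Longrightarrow> c \<in> B \<Longrightarrow> deg b \<le> deg c \<Longrightarrow> \<gamma> b (x + t *\<^sub>R c) = \<gamma> b x"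
  shows "distr M borel (\<lambda>x. x + (\<Sum>b\<in>B. \<gamma> b x *\<^sub>R b)) = M"
proof -
  have "C \<subseteq> B \<Longrightarrow> distr M borel (\<lambda>x. x + (\<Sum>b\<in>C. \<gamma> b x *\<^sub>R b)) = M" if "finite C" for C
    using that
  \<comment> \<open>The negated degree makes the induction add a vector \<open>b\<close> only after
    vectors \<open>c\<close> with \<open>deg b \<le> deg c\<close>.\<close>
  proof (induction C rule: finite_ranking_induct[where f = "\<lambda>b. - int (deg b)"])
    case empty
    show ?case using distr_id2[OF sets[symmetric]] by simp
  next
    case (insert b C)
    show ?case
    proof (cases "b \<in> C")
      case True
      then show ?thesis using insert by (simp add: insert_absorb)
    next
      case False
      define T where "T x = x + (\<Sum>c\<in>C. \<gamma> c x *\<^sub>R c)" for x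
      have \<gamma>_sum: "\<gamma> b (x + (\<Sum>c\<in>D. t c *\<^sub>R c)) = \<gamma> b x" if "finite D" "D \<subseteq> C" for D x t
        using that
      proof (induction D arbitrary: x)
        case (insert c D)
        have "\<gamma> b (x + (\<Sum>c\<in>insert c D. t c *\<^sub>R c)) = \<gamma> b ((x + (\<Sum>c\<in>D. t c *\<^sub>R c)) + t c *\<^sub>R c)"
          using insert by (simp add: algebra_simps)
        also have "\<dots> = \<gamma> b (x + (\<Sum>c\<in>D. t c *\<^sub>R c))"
        proof (rule \<gamma>_inv)
          show "deg b \<le> deg c"
            using \<open>\<And>y. y \<in> C \<Longrightarrow> - int (deg y) \<le> - int (deg b)\<close>[of c] insert.prems by simp
        qed (use \<open>insert b C \<subseteq> B\<close> insert.prems in auto)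
        also have "\<dots> = \<gamma> b x" using insert by simp
        finally show ?case .
      qed simp
      have [measurable]: "T \<in> borel_measurable borel"
        unfolding T_def using insert.prems
        by (intro borel_measurable_add borel_measurable_sum borel_measurable_scaleR \<gamma>) auto
      have [measurable]: "\<gamma> b \<in> borel_measurable borel"
        using insert.prems \<gamma> by simp
      \<comment> \<open>By \<open>\<gamma>_sum\<close>,
        \<open>\<gamma> b (T x) = \<gamma> b x\<close>.\<close>
      have "(\<lambda>x. x + (\<Sum>c\<in>insert b C. \<gamma> c x *\<^sub>R c)) = (\<lambda>x. x + \<gamma> b x *\<^sub>R b) \<circ> T"
        using False insert.hyps \<gamma>_sum[OF insert.hyps(1)]
        by (auto simp: T_def algebra_simps)
      then have "distr M borel (\<lambda>x. x + (\<Sum>c\<in>insert b C. \<gamma> c x *\<^sub>R c))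
          = distr (distr M borel T) borel (\<lambda>x. x + \<gamma> b x *\<^sub>R b)"
        by (simp add: distr_distr)
      also have "distr M borel T = M"
        using insert by (simp add: T_def[abs_def])
      also have "distr M borel (\<lambda>x. x + \<gamma> b x *\<^sub>R b) = M"
      proof (rule distr_shear)
        show "distr M borel (\<lambda>x. x + t *\<^sub>R b) = M" for t
          using insert.prems by (intro inv) simp
        show "\<gamma> b (x + t *\<^sub>R b) = \<gamma> b x" for x t
          using insert.prems by (intro \<gamma>_inv) simp_all
      qed (use \<open>sigma_finite_measure M\<close> in simp_all)
      finally show ?thesis .
    qed
  qed
  then show ?thesis using \<open>finite B\<close> by blast
qed

section \<open>The triangular form of the group product\<close>

text \<open>Each pair contributes at least 1 to the degree, so the degree bounds the length of the
  list as well as its entries.\<close>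

lemma finite_bch_words:
  "finite {ps. ps \<noteq> [] \<and> (\<forall>(r, s)\<in>set ps. 0 < r + s) \<and> bch_degree ps \<le> N}" (is "finite ?I")
proof (rule finite_subset)
  have len: "length ps \<le> bch_degree ps" if "\<forall>(r, s)\<in>set ps. 0 < r + s" for ps
    using that by (induction ps) (auto simp: bch_degree_def)
  have set: "r \<le> bch_degree ps \<and> s \<le> bch_degree ps" if "(r, s) \<in> set ps" for r s ps
    using that by (induction ps) (auto simp: bch_degree_def)
  show "?I \<subseteq> {ps. set ps \<subseteq> {..N} \<times> {..N} \<and> length ps \<le> N}"
    using len set by (fastforce intro: order_trans)
  show "finite {ps. set ps \<subseteq> {..N} \<times> {..N} \<and> length ps \<le> N}"
    by (rule finite_lists_length_le) simp
qed

lemma bch_word_Cons [simp]: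
  "bch_word x y ((r, s) # ps) = replicate r x @ replicate s y @ bch_word x y ps"
  by (simp add: bch_word_def)

lemma bch_word_Nil [simp]: "bch_word x y [] = []"
  by (simp add: bch_word_def)

lemma length_bch_word: "length (bch_word x y ps) = bch_degree ps"
  by (induction ps) (auto simp: bch_degree_def)

lemma set_bch_word: "set (bch_word x y ps) \<subseteq> {x, y}"
  by (induction ps) auto

lemma list_all2_bch_word:
  assumes "R x x'" "R y y'"
  shows "list_all2 R (bch_word x y ps) (bch_word x' y' ps)"
proof -
  have "list_all2 R (replicate n a) (replicate n b)" if "R a b" for n a b
    using that by (simp add: list_all2_conv_all_nth)
  then show ?thesis
    using assms by (induction ps) (auto intro!: list_all2_appendI)
qed

lemma map_bch_word: "map h (bch_word x y ps) = bch_word (h x) (h y) ps"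
  by (induction ps) auto

lemma bch_degree_eq_1:
  assumes "ps \<noteq> []" "\<forall>(r, s)\<in>set ps. 0 < r + s" "bch_degree ps \<le> 1"
  shows "ps = [(1, 0)] \<or> ps = [(0, 1)]"
proof -
  obtain r s qs where ps: "ps = (r, s) # qs" using assms(1) by (cases ps) auto
  have "qs = []"
  proof (cases qs)
    case (Cons p qs')
    then show ?thesis using assms ps by (cases p) (auto simp: bch_degree_def)
  qed
  moreover have "(r = 1 \<and> s = 0) \<or> (r = 0 \<and> s = 1)"
    using assms ps by (auto simp: bch_degree_def)
  ultimately show ?thesis using ps by auto
qed

definition bch_higher :: "('a::real_vector \<Rightarrow> 'a \<Rightarrow> 'a) \<Rightarrow> nat \<Rightarrow> 'a \<Rightarrow> 'a \<Rightarrow> 'a" where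
  "bch_higher br N x y =
     (\<Sum>ps | ps \<noteq> [] \<and> (\<forall>(r, s)\<in>set ps. 0 < r + s) \<and> bch_degree ps \<le> N \<and> 2 \<le> bch_degree ps.
        bch_coeff ps *\<^sub>R nested_br br (bch_word x y ps))"

text \<open>The words of degree 1 are \<open>x\<close> and \<open>y\<close>, both with coefficient
  1; all others contain a bracket.\<close>

lemma group_mult_eq:
  assumes "1 \<le> N"
  shows "group_mult br N x y = x + y + bch_higher br N x y"
proof -
  let ?f = "\<lambda>ps. bch_coeff ps *\<^sub>R nested_br br (bch_word x y ps)"
  let ?I = "{ps. ps \<noteq> [] \<and> (\<forall>(r, s)\<in>set ps. 0 < r + s) \<and> bch_degree ps \<le> N}"
  let ?J = "{ps. ps \<noteq> [] \<and> (\<forall>(r, s)\<in>set ps. 0 < r + s) \<and> bch_degree ps \<le> N \<and> 2 \<le> bch_degree ps}"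
  have I: "?I = {[(1, 0)], [(0, 1)]} \<union> ?J"
  proof (intro equalityI subsetI)
    fix ps assume "ps \<in> ?I"
    then show "ps \<in> {[(1, 0)], [(0, 1)]} \<union> ?J"
      using bch_degree_eq_1[of ps] by (cases "bch_degree ps \<le> 1") auto
  qed (use assms in \<open>auto simp: bch_degree_def\<close>)
  have "finite ?J" by (rule finite_subset[OF _ finite_bch_words[of N]]) auto
  then have "sum ?f ?I = sum ?f {[(1, 0)], [(0, 1)]} + sum ?f ?J"
    unfolding I by (intro sum.union_disjoint) (auto simp: bch_degree_def)
  also have "sum ?f {[(1, 0)], [(0, 1)]} = x + y"
    by (simp add: bch_coeff_def bch_degree_def bch_word_def)
  finally show ?thesis by (simp add: group_mult_def bch_higher_def)
qed

context graded_group
begin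

section \<open>Projections onto the layers\<close>

abbreviation P :: "nat \<Rightarrow> 'a \<Rightarrow> 'a" where "P \<equiv> layer_proj H \<iota>"

lemma layer_proj_spec:
  "(THE f. f \<in> PiE {1..\<iota>} H \<and> x = (\<Sum>i\<in>{1..\<iota>}. f i)) \<in> PiE {1..\<iota>} H"
  "x = (\<Sum>i\<in>{1..\<iota>}. P i x)"
  using theI'[OF direct_sum[of x]] by (auto simp: layer_proj_def)

lemma layer_proj_in: "i \<in> {1..\<iota>} \<Longrightarrow> P i x \<in> H i"
  using layer_proj_spec(1)[of x] unfolding layer_proj_def by blast

lemma layer_proj_sum:
  assumes "\<And>i. i \<in> {1..\<iota>} \<Longrightarrow> f i \<in> H i" and i: "i \<in> {1..\<iota>}"
  shows "P i (\<Sum>i\<in>{1..\<iota>}. f i) = f i"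
proof -
  let ?x = "\<Sum>i\<in>{1..\<iota>}. f i"
  have "restrict f {1..\<iota>} \<in> PiE {1..\<iota>} H \<and> ?x = (\<Sum>i\<in>{1..\<iota>}. restrict f {1..\<iota>} i)"
    using assms(1) by simp
  then have "(THE f. f \<in> PiE {1..\<iota>} H \<and> ?x = (\<Sum>i\<in>{1..\<iota>}. f i)) = restrict f {1..\<iota>}"
    by (rule the1_equality[OF direct_sum])
  then show ?thesis using i by (simp add: layer_proj_def)
qed

lemma linear_layer_proj:
  assumes i: "i \<in> {1..\<iota>}"
  shows "linear (P i)"
proof (rule linearI)
  have H: "j \<in> {1..\<iota>} \<Longrightarrow> subspace (H j)" for j using subspace_layer by simp
  fix x y and c :: real
  have "P i (\<Sum>j\<in>{1..\<iota>}. P j x + P j y) = P i x + P i y"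
    using i by (intro layer_proj_sum) (auto intro!: subspace_add H layer_proj_in simp del: One_nat_def)
  then show "P i (x + y) = P i x + P i y"
    by (simp only: sum.distrib layer_proj_spec(2)[symmetric])
  have "P i (\<Sum>j\<in>{1..\<iota>}. c *\<^sub>R P j x) = c *\<^sub>R P i x"
    using i by (intro layer_proj_sum) (auto intro!: subspace_scale H layer_proj_in simp del: One_nat_def)
  then show "P i (c *\<^sub>R x) = c *\<^sub>R P i x"
    by (simp only: scaleR_sum_right[symmetric] layer_proj_spec(2)[symmetric])
qed

lemma layer_proj_layer:
  assumes "i \<in> {1..\<iota>}" "j \<in> {1..\<iota>}" "x \<in> H j"
  shows "P i x = (if i = j then x else 0)"
proof -
  have "P i (\<Sum>k\<in>{1..\<iota>}. if k = j then x else 0) = (if i = j then x else 0)"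
    using assms subspace_0[OF subspace_layer] by (intro layer_proj_sum) auto
  then show ?thesis using assms(2) by simp
qed

lemma inner_layer:
  assumes "j \<in> {1..\<iota>}" "b \<in> H j"
  shows "x \<bullet> b = P j x \<bullet> b"
proof -
  have "x \<bullet> b = (\<Sum>i\<in>{1..\<iota>}. P i x \<bullet> b)"
    by (subst layer_proj_spec(2)) (simp add: inner_sum_left)
  also have "\<dots> = (\<Sum>i\<in>{1..\<iota>}. if i = j then P i x \<bullet> b else 0)"
    using assms orthogonal_layers[of _ j] layer_proj_in
    by (intro sum.cong) (auto simp: orthogonal_def)
  also have "\<dots> = P j x \<bullet> b" using assms by simp
  finally show ?thesis .
qed

lemma norm_layer_sum:
  assumes "\<And>i. i \<in> {1..\<iota>} \<Longrightarrow> f i \<in> H i"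
  shows "(norm (\<Sum>i\<in>{1..\<iota>}. f i))\<^sup>2 = (\<Sum>i\<in>{1..\<iota>}. (norm (f i))\<^sup>2)"
  using assms orthogonal_layers
  by (intro norm_sum_Pythagorean) (auto simp: pairwise_def)

section \<open>Brackets and the filtration by degree\<close>

text \<open>The sum of the layers of degree at least \<open>k\<close>. Two points are congruent
  modulo \<open>filtration k\<close> iff their layers below \<open>k\<close> agree.\<close>

definition filtration :: "nat \<Rightarrow> 'a set" where
  "filtration k = {x. \<forall>i\<in>{1..\<iota>}. i < k \<longrightarrow> P i x = 0}"

lemma subspace_filtration: "subspace (filtration k)"
  by (simp add: subspace_def filtration_def linear_0[OF linear_layer_proj]
      linear_add[OF linear_layer_proj] linear_scale[OF linear_layer_proj])

lemma layer_subset_filtration: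
  assumes "1 \<le> j" "k \<le> j"
  shows "H j \<subseteq> filtration k"
proof
  fix x assume x: "x \<in> H j"
  show "x \<in> filtration k"
  proof (cases "j \<le> \<iota>")
    case True
    then have "P i x = 0" if "i \<in> {1..\<iota>}" "i < k" for i
      using assms that layer_proj_layer[of i j x] x by simp
    then show ?thesis by (simp add: filtration_def)
  next
    case False
    then have "x = 0" using layer_above[of j] x by simp
    then show ?thesis using subspace_0[OF subspace_filtration] by simp
  qed
qed

text \<open>All layers have degree at least 1, so bracketing with any \<open>y\<close> raises the
  degree.\<close>

lemma br_filtration_left:
  assumes "x \<in> filtration k"
  shows "br x y \<in> filtration (Suc k)"
proof -
  have "br x y = br (\<Sum>i\<in>{1..\<iota>}. P i x) (\<Sum>j\<in>{1..\<iota>}. P j y)"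
    by (simp only: layer_proj_spec(2)[symmetric])
  also have "\<dots> = (\<Sum>(i, j)\<in>{1..\<iota>} \<times> {1..\<iota>}. br (P i x) (P j y))"
    by (rule bilinear_sum[OF bilinear_br])
  also have "\<dots> \<in> filtration (Suc k)"
  proof (rule subspace_sum[OF subspace_filtration], clarify)
    fix i j assume ij: "i \<in> {1..\<iota>}" "j \<in> {1..\<iota>}"
    show "br (P i x) (P j y) \<in> filtration (Suc k)"
    proof (cases "i < k")
      case True
      then have "P i x = 0" using assms ij by (simp add: filtration_def)
      then show ?thesis
        using bilinear_lzero[OF bilinear_br] subspace_0[OF subspace_filtration] by simp
    next
      case False
      then show ?thesis
        using ij br_layers[of i j "P i x" "P j y"] layer_proj_in layer_subset_filtration[of "i + j" "Suc k"]
        by auto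
    qed
  qed
  finally show ?thesis .
qed

text \<open>Expanding \<open>br (x + y) (x + y) = 0\<close> gives skew symmetry, which reduces the
  claim to the other argument.\<close>

lemma br_filtration_right:
  assumes "x \<in> filtration k"
  shows "br y x \<in> filtration (Suc k)"
proof -
  have "br (x + y) (x + y) = br x (x + y) + br y (x + y)"
    by (rule bilinear_ladd[OF bilinear_br])
  also have "\<dots> = br x y + br y x"
    by (simp add: bilinear_radd[OF bilinear_br] br_self)
  finally have "br x y + br y x = 0"
    by (simp add: br_self)
  then have "br y x = - br x y"
    by (simp add: add_eq_0_iff)
  then show ?thesis
    using br_filtration_left[OF assms] subspace_neg[OF subspace_filtration] by simp
qed

lemma br_diff_filtration:
  assumes "a - a' \<in> filtration k" "u - u' \<in> filtration k"
  shows "br a u - br a' u' \<in> filtration (Suc k)"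
proof -
  have "br a u - br a' u' = br (a - a') u + br a' (u - u')"
    by (simp add: bilinear_lsub[OF bilinear_br] bilinear_rsub[OF bilinear_br])
  then show ?thesis
    using assms br_filtration_left br_filtration_right subspace_add[OF subspace_filtration] by simp
qed

lemma filtration_Suc: "filtration (Suc k) \<subseteq> filtration k"
  by (auto simp: filtration_def)

lemma nested_br_filtration:
  assumes "list_all2 (\<lambda>x y. x - y \<in> filtration k) xs ys"
  shows "nested_br br xs - nested_br br ys \<in> filtration k"
  using assms
proof (induction br\<equiv>br xs arbitrary: ys rule: nested_br.induct)
  case 1
  then show ?case using subspace_0[OF subspace_filtration] by simp
next
  case (2 x)
  then show ?case by (auto simp: list_all2_Cons1)
next
  case (3 x y zs)
  then obtain x' y' zs' where ys: "ys = x' # y' # zs'" "x - x' \<in> filtration k"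
    "list_all2 (\<lambda>x y. x - y \<in> filtration k) (y # zs) (y' # zs')"
    by (auto simp: list_all2_Cons1)
  have "br x (nested_br br (y # zs)) - br x' (nested_br br (y' # zs')) \<in> filtration (Suc k)"
    using ys 3(1) by (intro br_diff_filtration) auto
  then show ?case using filtration_Suc ys(1) by auto
qed

text \<open>A word of length at least 2 has an outermost bracket, and this bracket gains one degree
  over the congruence of the letters.\<close>

lemma nested_br_filtration_Suc:
  assumes "list_all2 (\<lambda>x y. x - y \<in> filtration k) xs ys" "2 \<le> length xs"
  shows "nested_br br xs - nested_br br ys \<in> filtration (Suc k)"
proof -
  obtain x x2 zs where xs: "xs = x # x2 # zs"
    using assms(2) by (metis One_nat_def Suc_1 Suc_le_length_iff)
  then obtain y y2 zs' where ys: "ys = y # y2 # zs'" "x - y \<in> filtration k"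
    "list_all2 (\<lambda>x y. x - y \<in> filtration k) (x2 # zs) (y2 # zs')"
    using assms(1) by (auto simp: list_all2_Cons1)
  then show ?thesis
    using br_diff_filtration[OF ys(2) nested_br_filtration[OF ys(3)]] xs by simp
qed

text \<open>The triangular form of the product: layer \<open>k\<close> of the higher terms depends
  only on the layers of \<open>y\<close> below \<open>k\<close>.\<close>

lemma bch_higher_filtration:
  assumes "y - y' \<in> filtration k"
  shows "bch_higher br \<iota> x y - bch_higher br \<iota> x y' \<in> filtration (Suc k)"
  unfolding bch_higher_def sum_subtractf[symmetric] scaleR_diff_right[symmetric]
proof (intro subspace_sum[OF subspace_filtration] subspace_scale[OF subspace_filtration]
    nested_br_filtration_Suc)
  show "list_all2 (\<lambda>x y. x - y \<in> filtration k) (bch_word x y ps) (bch_word x y' ps)" for ps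
    using assms subspace_0[OF subspace_filtration] by (intro list_all2_bch_word) auto
qed (auto simp: length_bch_word)

text \<open>Every innermost bracket is formed from multiples of \<open>z\<close> and
  vanishes.\<close>

lemma bch_higher_inverse: "bch_higher br \<iota> (- z) z = 0"
proof -
  have br0: "br a b = 0" if "a \<in> {- z, z}" "b \<in> {- z, z}" for a b
    using that by (auto simp: bilinear_lneg[OF bilinear_br] bilinear_rneg[OF bilinear_br] br_self)
  have *: "nested_br br xs = 0" if "set xs \<subseteq> {- z, z}" "2 \<le> length xs" for xs
    using that
  proof (induction br\<equiv>br xs rule: nested_br.induct)
    case (3 x y zs)
    show ?case
    proof (cases zs)
      case Nil
      then show ?thesis using 3 br0[of x y] by simp
    next
      case Cons
      then show ?thesis using 3 by (simp add: bilinear_rzero[OF bilinear_br])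
    qed
  qed auto
  show ?thesis
    unfolding bch_higher_def
    using *[OF set_bch_word] by (intro sum.neutral) (auto simp: length_bch_word)
qed

lemma group_mult_inverse: "group_mult br \<iota> (- z) z = 0"
  using step_pos by (simp add: group_mult_eq bch_higher_inverse)

text \<open>The letters are functions of the variable, so that one induction covers words that mix
  constant and varying letters.\<close>

lemma continuous_nested_br:
  assumes "\<And>f. f \<in> set fs \<Longrightarrow> continuous_on S f"
  shows "continuous_on S (\<lambda>x. nested_br br (map (\<lambda>f. f x) fs))"
  using assms
proof (induction fs rule: induct_list012)
  case (3 f g fs)
  have "bounded_bilinear br"
    using bilinear_br by (simp add: bilinear_conv_bounded_bilinear)
  then have "continuous_on S (\<lambda>x. br (f x) (nested_br br (map (\<lambda>f. f x) (g # fs))))"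
  proof (rule bounded_bilinear.continuous_on)
    show "continuous_on S f" using 3(3) by simp
    show "continuous_on S (\<lambda>x. nested_br br (map (\<lambda>f. f x) (g # fs)))"
      by (rule 3(2)) (use 3(3) in simp)
  qed
  then show ?case by simp
qed auto

lemma continuous_bch_higher: "continuous_on S (bch_higher br \<iota> x)"
proof -
  have "continuous_on S (\<lambda>y. nested_br br (bch_word x y ps))" for ps
  proof -
    have "continuous_on S f" if "f \<in> set (bch_word (\<lambda>_. x) (\<lambda>y. y) ps)" for f
      using that set_bch_word[of "\<lambda>_. x" "\<lambda>y. y" ps] by (auto intro: continuous_intros)
    then have "continuous_on S (\<lambda>y. nested_br br (map (\<lambda>f. f y) (bch_word (\<lambda>_. x) (\<lambda>y. y) ps)))"
      by (rule continuous_nested_br)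
    then show ?thesis by (simp add: map_bch_word)
  qed
  then show ?thesis
    unfolding bch_higher_def[abs_def] by (intro continuous_intros)
qed

end

section \<open>Slices of layerwise solid sets\<close>

text \<open>This records what the monotonicity of \<phi> says about the unit ball, without reference
  to \<phi>.\<close>

definition layer_solid :: "(nat \<Rightarrow> 'a::euclidean_space set) \<Rightarrow> nat \<Rightarrow> 'a set \<Rightarrow> bool" where
  "layer_solid H \<iota> A \<longleftrightarrow> (\<forall>x\<in>A. \<forall>y.
     (\<forall>i\<in>{1..\<iota>}. norm (layer_proj H \<iota> i y) \<le> norm (layer_proj H \<iota> i x)) \<longrightarrow> y \<in> A)"

text \<open>The sum is the orthogonal projection \<open>p\<close> of \<open>x\<close>; it satisfies
  \<open>p \<bullet> p = x \<bullet> p\<close>, and Cauchy-Schwarz applies.\<close>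

lemma norm_orthonormal_sum_le:
  fixes B :: "'a::euclidean_space set"
  assumes "finite B" "pairwise orthogonal B" "\<And>b. b \<in> B \<Longrightarrow> norm b = 1"
  shows "norm (\<Sum>b\<in>B. (x \<bullet> b) *\<^sub>R b) \<le> norm x"
proof -
  let ?p = "\<Sum>b\<in>B. (x \<bullet> b) *\<^sub>R b"
  have "?p \<bullet> b = x \<bullet> b" if "b \<in> B" for b
  proof -
    have "?p \<bullet> b = (\<Sum>c\<in>B. (x \<bullet> c) * (c \<bullet> b))"
      by (simp add: inner_sum_left)
    also have "\<dots> = (\<Sum>c\<in>B. if c = b then x \<bullet> c else 0)"
      using assms(2,3) that
      by (intro sum.cong) (auto simp: pairwise_def orthogonal_def norm_eq_1)
    finally show ?thesis using that assms(1) by simp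
  qed
  then have "?p \<bullet> ?p = x \<bullet> ?p"
    by (simp add: inner_sum_right)
  also have "\<dots> \<le> norm x * norm ?p"
    by (rule norm_cauchy_schwarz)
  finally have "norm ?p * norm ?p \<le> norm x * norm ?p"
    by (simp add: power2_norm_eq_inner[symmetric] power2_eq_square)
  then show ?thesis
    by (cases "?p = 0") (simp_all del: norm_eq_zero)
qed

section \<open>Sums of subspaces of the layers\<close>

definition layer_sum :: "nat \<Rightarrow> (nat \<Rightarrow> 'a::real_vector set) \<Rightarrow> 'a set" where
  "layer_sum \<iota> W = {\<Sum>i\<in>{1..\<iota>}. f i | f. f \<in> PiE {1..\<iota>} W}"

lemma layer_sum_iff: "x \<in> layer_sum \<iota> W \<longleftrightarrow> (\<exists>f. (\<forall>i\<in>{1..\<iota>}. f i \<in> W i) \<and> x = (\<Sum>i\<in>{1..\<iota>}. f i))"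
proof
  assume "\<exists>f. (\<forall>i\<in>{1..\<iota>}. f i \<in> W i) \<and> x = (\<Sum>i\<in>{1..\<iota>}. f i)"
  then obtain f where "\<forall>i\<in>{1..\<iota>}. f i \<in> W i" "x = (\<Sum>i\<in>{1..\<iota>}. f i)" by blast
  then have "restrict f {1..\<iota>} \<in> PiE {1..\<iota>} W" "x = (\<Sum>i\<in>{1..\<iota>}. restrict f {1..\<iota>} i)"
    by auto
  then show "x \<in> layer_sum \<iota> W" unfolding layer_sum_def by blast
qed (auto simp: layer_sum_def PiE_iff)

context graded_group
begin

lemma layer_sum_iff_proj:
  assumes "\<And>i. i \<in> {1..\<iota>} \<Longrightarrow> W i \<subseteq> H i"
  shows "x \<in> layer_sum \<iota> W \<longleftrightarrow> (\<forall>i\<in>{1..\<iota>}. P i x \<in> W i)"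
proof
  assume "x \<in> layer_sum \<iota> W"
  then obtain f where f: "\<forall>i\<in>{1..\<iota>}. f i \<in> W i" and x: "x = (\<Sum>i\<in>{1..\<iota>}. f i)"
    unfolding layer_sum_iff by blast
  then have "P i x = f i" if "i \<in> {1..\<iota>}" for i
    unfolding x using assms that by (intro layer_proj_sum) blast+
  then show "\<forall>i\<in>{1..\<iota>}. P i x \<in> W i" using f by simp
next
  assume "\<forall>i\<in>{1..\<iota>}. P i x \<in> W i"
  then show "x \<in> layer_sum \<iota> W"
    unfolding layer_sum_iff using layer_proj_spec(2) by (intro exI[of _ "\<lambda>i. P i x"]) blast
qed

lemma subspace_layer_sum:
  assumes W: "\<And>i. i \<in> {1..\<iota>} \<Longrightarrow> subspace (W i)" "\<And>i. i \<in> {1..\<iota>} \<Longrightarrow> W i \<subseteq> H i"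
  shows "subspace (layer_sum \<iota> W)"
proof -
  have iff: "x \<in> layer_sum \<iota> W \<longleftrightarrow> (\<forall>i\<in>{1..\<iota>}. P i x \<in> W i)" for x
    using W(2) by (rule layer_sum_iff_proj)
  show ?thesis
    by (rule subspaceI) (simp_all add: iff W(1) linear_0[OF linear_layer_proj] linear_add[OF linear_layer_proj]
        linear_scale[OF linear_layer_proj] subspace_0 subspace_add subspace_scale)
qed

text \<open>Orthonormal bases of the \<open>W i\<close> are united; they are mutually orthogonal
  because the layers are. The function \<open>deg\<close> records the layer of each basis vector, as
  the triangular shear requires.\<close>

lemma layer_sum_orthonormal_basis:
  assumes W: "\<And>i. i \<in> {1..\<iota>} \<Longrightarrow> subspace (W i)" "\<And>i. i \<in> {1..\<iota>} \<Longrightarrow> W i \<subseteq> H i"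
  obtains B deg where "finite B" "pairwise orthogonal B" "\<And>b. b \<in> B \<Longrightarrow> norm b = 1"
    "span B = layer_sum \<iota> W" "card B = (\<Sum>i\<in>{1..\<iota>}. dim (W i))"
    "\<And>b. b \<in> B \<Longrightarrow> deg b \<in> {1..\<iota>} \<and> b \<in> H (deg b)"
proof -
  have iff: "x \<in> layer_sum \<iota> W \<longleftrightarrow> (\<forall>i\<in>{1..\<iota>}. P i x \<in> W i)" for x
    using W(2) by (rule layer_sum_iff_proj)
  have "\<exists>C. C \<subseteq> W i \<and> pairwise orthogonal C \<and> (\<forall>b\<in>C. norm b = 1) \<and> independent C \<and>
      card C = dim (W i) \<and> span C = W i" if "i \<in> {1..\<iota>}" for i
    by (rule orthonormal_basis_subspace[OF W(1)[OF that]]) blast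
  then have "\<exists>C. \<forall>i\<in>{1..\<iota>}. C i \<subseteq> W i \<and> pairwise orthogonal (C i) \<and> (\<forall>b\<in>C i. norm b = 1) \<and>
      independent (C i) \<and> card (C i) = dim (W i) \<and> span (C i) = W i"
    by (intro bchoice ballI)
  then obtain C where C: "\<And>i. i \<in> {1..\<iota>} \<Longrightarrow> C i \<subseteq> W i"
      "\<And>i. i \<in> {1..\<iota>} \<Longrightarrow> pairwise orthogonal (C i)"
      "\<And>i b. i \<in> {1..\<iota>} \<Longrightarrow> b \<in> C i \<Longrightarrow> norm b = 1"
      "\<And>i. i \<in> {1..\<iota>} \<Longrightarrow> independent (C i)"
      "\<And>i. i \<in> {1..\<iota>} \<Longrightarrow> card (C i) = dim (W i)"
      "\<And>i. i \<in> {1..\<iota>} \<Longrightarrow> span (C i) = W i"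
    by blast
  define B where "B = (\<Union>i\<in>{1..\<iota>}. C i)"
  have "\<exists>deg. \<forall>b\<in>B. deg b \<in> {1..\<iota>} \<and> b \<in> C (deg b)"
    by (rule bchoice) (auto simp: B_def)
  then obtain deg where deg: "\<And>b. b \<in> B \<Longrightarrow> deg b \<in> {1..\<iota>} \<and> b \<in> C (deg b)"
    by blast
  have orth: "orthogonal b c" if "i \<in> {1..\<iota>}" "j \<in> {1..\<iota>}" "b \<in> C i" "c \<in> C j" "b \<noteq> c" for b c i j
  proof (cases "i = j")
    case True
    then show ?thesis using that C(2)[of i] by (simp add: pairwise_def)
  next
    case False
    moreover have "b \<in> H i" "c \<in> H j" using that C(1) W(2) by blast+
    ultimately show ?thesis using that orthogonal_layers by blast
  qed
  have finC: "finite (C i)" if "i \<in> {1..\<iota>}" for i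
    using C(4)[OF that] independent_imp_finite by blast
  \<comment> \<open>A common vector would be orthogonal to itself and yet have norm 1.\<close>
  have disj: "C i \<inter> C j = {}" if "i \<in> {1..\<iota>}" "j \<in> {1..\<iota>}" "i \<noteq> j" for i j
  proof (rule ccontr)
    assume "C i \<inter> C j \<noteq> {}"
    then obtain b where "b \<in> C i" "b \<in> C j" by blast
    then have "orthogonal b b" "norm b = 1"
      using that orthogonal_layers[of i j b b] C(1,3) W(2) by blast+
    then show False by (simp add: orthogonal_self)
  qed
  show thesis
  proof
    show "finite B" using finC by (simp add: B_def)
    show "pairwise orthogonal B"
      unfolding pairwise_def B_def using orth by blast
    show "norm b = 1" if "b \<in> B" for b
      using that C(3) unfolding B_def by blast
    show "deg b \<in> {1..\<iota>} \<and> b \<in> H (deg b)" if "b \<in> B" for b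
      using deg[OF that] C(1) W(2) by blast
    show "card B = (\<Sum>i\<in>{1..\<iota>}. dim (W i))"
      unfolding B_def using finC disj C(5)
      by (subst card_UN_disjoint) (simp_all add: del: One_nat_def)
    show "span B = layer_sum \<iota> W"
    proof (intro equalityI subsetI)
      have sub: "subspace (layer_sum \<iota> W)" using W by (rule subspace_layer_sum)
      have "C i \<subseteq> layer_sum \<iota> W" if i: "i \<in> {1..\<iota>}" for i
      proof
        fix b assume b: "b \<in> C i"
        then have "b \<in> H i" using C(1) W(2) i by blast
        then show "b \<in> layer_sum \<iota> W"
          using W(1) b C(1) i unfolding iff
          by (auto simp: layer_proj_layer[of _ i] subspace_0)
      qed
      then have "span B \<subseteq> layer_sum \<iota> W"
        unfolding B_def using sub by (intro span_minimal) blast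
      then show "x \<in> layer_sum \<iota> W" if "x \<in> span B" for x using that by blast
      fix x assume "x \<in> layer_sum \<iota> W"
      then have *: "P i x \<in> span (C i)" if "i \<in> {1..\<iota>}" for i
        using that iff C(6) by simp
      have "P i x \<in> span B" if "i \<in> {1..\<iota>}" for i
        using *[OF that] span_mono[of "C i" B] that unfolding B_def by blast
      then show "x \<in> span B"
        by (subst layer_proj_spec(2)) (rule span_sum)
    qed
  qed
qed

lemma dim_layer_sum:
  assumes W: "\<And>i. i \<in> {1..\<iota>} \<Longrightarrow> subspace (W i)" "\<And>i. i \<in> {1..\<iota>} \<Longrightarrow> W i \<subseteq> H i"
  shows "dim (layer_sum \<iota> W) = (\<Sum>i\<in>{1..\<iota>}. dim (W i))"
proof -
  obtain B deg where B: "pairwise orthogonal B" "\<And>b. b \<in> B \<Longrightarrow> norm b = 1"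
    "span B = layer_sum \<iota> W" "card B = (\<Sum>i\<in>{1..\<iota>}. dim (W i))"
    using layer_sum_orthonormal_basis[OF W] by metis
  then have "independent B"
    by (intro pairwise_orthogonal_independent) force+
  then show ?thesis
    using B(3,4) dim_span_eq_card_independent by metis
qed

section \<open>Comparison of slices\<close>

text \<open>On \<open>V\<close> the map \<open>T\<close> sends \<open>x\<close> to the orthogonal
  projection of \<open>group_mult br \<iota> z x\<close>. It preserves the measure, being a
  triangular shear, and it maps the translated slice into \<open>A\<close>, which is solid.\<close>

lemma hausdorff_measure_slice_le:
  assumes W: "\<And>i. i \<in> {1..\<iota>} \<Longrightarrow> subspace (W i)" "\<And>i. i \<in> {1..\<iota>} \<Longrightarrow> W i \<subseteq> H i"
    and V: "V = layer_sum \<iota> W"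
    and A: "A \<in> sets borel" "layer_solid H \<iota> A"
  shows "hausdorff_measure (dim V) (V \<inter> {x. group_mult br \<iota> z x \<in> A})
    \<le> hausdorff_measure (dim V) (V \<inter> A)"
proof -
  obtain B deg where fin: "finite B" and orth: "pairwise orthogonal B" "\<And>b. b \<in> B \<Longrightarrow> norm b = 1"
    and span: "span B = V" and deg: "\<And>b. b \<in> B \<Longrightarrow> deg b \<in> {1..\<iota>}" "\<And>b. b \<in> B \<Longrightarrow> b \<in> H (deg b)"
    using layer_sum_orthonormal_basis[OF W] V by metis
  have subV: "subspace V" using span subspace_span by metis
  have BV: "b \<in> V" if "b \<in> B" for b using that span span_base by blast
  \<comment> \<open>The coefficient along \<open>b\<close> of the displacement from \<open>x\<close>
    to \<open>group_mult br \<iota> z x\<close>.\<close>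
  define \<gamma> where "\<gamma> b x = (z + bch_higher br \<iota> z x) \<bullet> b" for b x
  define T where "T x = x + (\<Sum>b\<in>B. \<gamma> b x *\<^sub>R b)" for x
  have \<gamma>_meas: "\<gamma> b \<in> borel_measurable borel" for b
    unfolding \<gamma>_def[abs_def]
    by (intro borel_measurable_continuous_onI continuous_intros continuous_bch_higher)
  have \<gamma>_inv: "\<gamma> b (x + t *\<^sub>R c) = \<gamma> b x" if "b \<in> B" "c \<in> B" "deg b \<le> deg c" for b c x t
  proof -
    \<comment> \<open>Moving along \<open>c\<close> changes only layers of degree at least
      \<open>deg b\<close>, hence the higher terms only in layers above \<open>deg b\<close>, which
      are orthogonal to \<open>b\<close>.\<close>
    have "c \<in> filtration (deg b)"
      using layer_subset_filtration[of "deg c" "deg b"] that deg by auto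
    then have "(x + t *\<^sub>R c) - x \<in> filtration (deg b)"
      by (simp add: subspace_scale[OF subspace_filtration])
    then have "P (deg b) (bch_higher br \<iota> z (x + t *\<^sub>R c) - bch_higher br \<iota> z x) = 0"
      using bch_higher_filtration deg(1)[OF that(1)] by (simp add: filtration_def)
    then have "(bch_higher br \<iota> z (x + t *\<^sub>R c) - bch_higher br \<iota> z x) \<bullet> b = 0"
      by (subst inner_layer[OF deg(1)[OF that(1)] deg(2)[OF that(1)]]) simp
    then show ?thesis by (simp add: \<gamma>_def algebra_simps)
  qed
  have "distr (subspace_measure V) borel T = subspace_measure V"
    unfolding T_def[abs_def]
  proof (rule distr_triangular_shear[where deg = deg])
    show "sigma_finite_measure (subspace_measure V)"
      using subV by (rule sigma_finite_subspace_measure)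
    show "distr (subspace_measure V) borel (\<lambda>x. x + t *\<^sub>R b) = subspace_measure V"
      if "b \<in> B" for b t
      using distr_translation_subspace_measure[OF subV] subspace_scale[OF subV BV[OF that]] .
  qed (simp_all add: fin \<gamma>_meas \<gamma>_inv)
  moreover have T: "T \<in> borel_measurable borel"
    unfolding T_def[abs_def]
    by (intro borel_measurable_add borel_measurable_sum borel_measurable_scaleR \<gamma>_meas) auto
  ultimately have "hausdorff_measure (dim V) (V \<inter> A)
      = emeasure (subspace_measure V) (T -` A)"
    using emeasure_distr[of T "subspace_measure V" borel A] A(1)
    by (simp add: emeasure_subspace_measure subV)
  also have "T -` A \<in> sets borel"
    using measurable_sets[OF T A(1)] by simp
  then have "emeasure (subspace_measure V) (T -` A) = hausdorff_measure (dim V) (V \<inter> T -` A)"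
    using subV by (intro emeasure_subspace_measure)
  finally have eq: "hausdorff_measure (dim V) (V \<inter> T -` A) = hausdorff_measure (dim V) (V \<inter> A)" ..
  have "T x \<in> A" if x: "x \<in> V" and g: "group_mult br \<iota> z x \<in> A" for x
  proof -
    define g where "g = group_mult br \<iota> z x"
    \<comment> \<open>Here \<open>x \<in> V\<close> is essential: only on \<open>V\<close> does
      \<open>T\<close> agree with the projection of the product.\<close>
    have "x = (\<Sum>b\<in>B. (x \<bullet> b) *\<^sub>R b)"
      using orthonormal_basis_expand[OF orth _ fin, of x] x span by simp
    then have "T x = (\<Sum>b\<in>B. (x \<bullet> b) *\<^sub>R b) + (\<Sum>b\<in>B. \<gamma> b x *\<^sub>R b)"
      unfolding T_def by simp
    also have "\<dots> = (\<Sum>b\<in>B. (g \<bullet> b) *\<^sub>R b)"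
      using step_pos
      by (simp add: g_def group_mult_eq \<gamma>_def inner_add_left algebra_simps sum.distrib)
    finally have Tx: "T x = (\<Sum>b\<in>B. (g \<bullet> b) *\<^sub>R b)" .
    \<comment> \<open>The basis vectors lie in single layers, so the projection acts on each layer
      separately and decreases its norm.\<close>
    have "norm (P i (T x)) \<le> norm (P i g)" if i: "i \<in> {1..\<iota>}" for i
    proof -
      define C where "C = {b\<in>B. deg b = i}"
      have "P i (T x) = (\<Sum>b\<in>B. (g \<bullet> b) *\<^sub>R P i b)"
        unfolding Tx using linear_layer_proj[OF i] by (simp add: linear_sum linear_scale)
      also have "\<dots> = (\<Sum>b\<in>B. if deg b = i then (P i g \<bullet> b) *\<^sub>R b else 0)"
      proof (rule sum.cong)
        fix b assume "b \<in> B"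
        then have b: "deg b \<in> {1..\<iota>}" "b \<in> H (deg b)" using deg by blast+
        show "(g \<bullet> b) *\<^sub>R P i b = (if deg b = i then (P i g \<bullet> b) *\<^sub>R b else 0)"
          using layer_proj_layer[OF i b] inner_layer[OF b, of g] by auto
      qed simp
      also have "\<dots> = (\<Sum>b\<in>C. (P i g \<bullet> b) *\<^sub>R b)"
        unfolding C_def using fin by (simp add: sum.inter_filter)
      also have "norm \<dots> \<le> norm (P i g)"
        using orth fin by (intro norm_orthonormal_sum_le) (auto simp: C_def pairwise_def)
      finally show ?thesis .
    qed
    then show ?thesis
      using A(2) g unfolding layer_solid_def g_def[symmetric] by blast
  qed
  then have "V \<inter> {x. group_mult br \<iota> z x \<in> A} \<subseteq> V \<inter> T -` A" by blast
  then show ?thesis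
    using hausdorff_measure_mono eq by metis
qed

text \<open>Isometries of \<open>W i\<close> onto \<open>W' i\<close> add up to an isometric map
  \<open>L\<close> of one sum onto the other that keeps the norm of every layer, hence respects
  solid sets. The reverse inequality follows by exchanging \<open>W\<close> and
  \<open>W'\<close>.\<close>

lemma hausdorff_measure_layer_sum_le:
  assumes W: "\<And>i. i \<in> {1..\<iota>} \<Longrightarrow> subspace (W i)" "\<And>i. i \<in> {1..\<iota>} \<Longrightarrow> W i \<subseteq> H i"
    and W': "\<And>i. i \<in> {1..\<iota>} \<Longrightarrow> subspace (W' i)" "\<And>i. i \<in> {1..\<iota>} \<Longrightarrow> W' i \<subseteq> H i"
    and dim: "\<And>i. i \<in> {1..\<iota>} \<Longrightarrow> dim (W i) = dim (W' i)"
    and A: "layer_solid H \<iota> A"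
  shows "hausdorff_measure n (layer_sum \<iota> W' \<inter> A) \<le> hausdorff_measure n (layer_sum \<iota> W \<inter> A)"
proof -
  have "\<exists>f. linear f \<and> f ` W i = W' i \<and> (\<forall>x\<in>W i. norm (f x) = norm x)" if "i \<in> {1..\<iota>}" for i
    by (rule isometries_subspaces[OF W(1)[OF that] W'(1)[OF that] dim[OF that]]) blast
  then have "\<exists>F. \<forall>i\<in>{1..\<iota>}. linear (F i) \<and> F i ` W i = W' i \<and> (\<forall>x\<in>W i. norm (F i x) = norm x)"
    by (intro bchoice ballI)
  then obtain F where F: "\<And>i. i \<in> {1..\<iota>} \<Longrightarrow> linear (F i)" "\<And>i. i \<in> {1..\<iota>} \<Longrightarrow> F i ` W i = W' i"
    "\<And>i x. i \<in> {1..\<iota>} \<Longrightarrow> x \<in> W i \<Longrightarrow> norm (F i x) = norm x"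
    by blast
  define L where "L x = (\<Sum>i\<in>{1..\<iota>}. F i (P i x))" for x
  have iff: "x \<in> layer_sum \<iota> W \<longleftrightarrow> (\<forall>i\<in>{1..\<iota>}. P i x \<in> W i)" for x
    using W(2) by (rule layer_sum_iff_proj)
  have iff': "x \<in> layer_sum \<iota> W' \<longleftrightarrow> (\<forall>i\<in>{1..\<iota>}. P i x \<in> W' i)" for x
    using W'(2) by (rule layer_sum_iff_proj)
  have "norm (L x) = norm x" if "x \<in> layer_sum \<iota> W" for x
  proof -
    have x: "P i x \<in> W i" if "i \<in> {1..\<iota>}" for i
      using \<open>x \<in> layer_sum \<iota> W\<close> iff that by blast
    then have "F i (P i x) \<in> H i" if "i \<in> {1..\<iota>}" for i
      using F(2) W'(2) that by blast
    then have "(norm (L x))\<^sup>2 = (\<Sum>i\<in>{1..\<iota>}. (norm (F i (P i x)))\<^sup>2)"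
      unfolding L_def by (rule norm_layer_sum)
    also have "\<dots> = (\<Sum>i\<in>{1..\<iota>}. (norm (P i x))\<^sup>2)"
      using F(3) x by (intro sum.cong) auto
    also have "\<dots> = (norm (\<Sum>i\<in>{1..\<iota>}. P i x))\<^sup>2"
      by (rule norm_layer_sum[symmetric]) (rule layer_proj_in)
    also have "\<dots> = (norm x)\<^sup>2"
      by (simp only: layer_proj_spec(2)[symmetric])
    finally show ?thesis by (simp add: power2_eq_iff_nonneg)
  qed
  moreover have "L x - L y = L (x - y)" for x y
    using F(1) linear_layer_proj by (simp add: L_def linear_diff flip: sum_subtractf)
  ultimately have lip: "dist (L x) (L y) \<le> dist x y"
    if "x \<in> layer_sum \<iota> W" "y \<in> layer_sum \<iota> W" for x y
    using subspace_diff[OF subspace_layer_sum[OF W] that] by (simp add: dist_norm)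
  \<comment> \<open>A preimage of \<open>y\<close> is chosen layer by layer; its layers have the
    same norms as those of \<open>y\<close>, so it lies in \<open>A\<close>.\<close>
  have "layer_sum \<iota> W' \<inter> A \<subseteq> L ` (layer_sum \<iota> W \<inter> A)"
  proof
    fix y assume y: "y \<in> layer_sum \<iota> W' \<inter> A"
    then have "\<exists>w. w \<in> W i \<and> F i w = P i y" if "i \<in> {1..\<iota>}" for i
      using iff' F(2) that by (metis IntD1 imageE)
    then have "\<exists>w. \<forall>i\<in>{1..\<iota>}. w i \<in> W i \<and> F i (w i) = P i y"
      by (intro bchoice ballI)
    then obtain w where w: "\<And>i. i \<in> {1..\<iota>} \<Longrightarrow> w i \<in> W i" "\<And>i. i \<in> {1..\<iota>} \<Longrightarrow> F i (w i) = P i y"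
      by blast
    define x where "x = (\<Sum>i\<in>{1..\<iota>}. w i)"
    have Px: "P i x = w i" if "i \<in> {1..\<iota>}" for i
      unfolding x_def using w(1) W(2) that by (intro layer_proj_sum) blast+
    have "L x = (\<Sum>i\<in>{1..\<iota>}. P i y)"
      unfolding L_def using Px w(2) by (intro sum.cong) auto
    also have "\<dots> = y" by (rule layer_proj_spec(2)[symmetric])
    finally have "y = L x" ..
    moreover have "x \<in> layer_sum \<iota> W" using iff Px w(1) by simp
    moreover have "norm (P i x) \<le> norm (P i y)" if "i \<in> {1..\<iota>}" for i
      using F(3)[OF that w(1)[OF that]] w(2)[OF that] Px[OF that] by simp
    then have "x \<in> A" using A y unfolding layer_solid_def by blast
    ultimately show "y \<in> L ` (layer_sum \<iota> W \<inter> A)" by blast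
  qed
  then have "hausdorff_measure n (layer_sum \<iota> W' \<inter> A)
      \<le> hausdorff_measure n (L ` (layer_sum \<iota> W \<inter> A))"
    by (rule hausdorff_measure_mono)
  also have "\<dots> \<le> hausdorff_measure n (layer_sum \<iota> W \<inter> A)"
    using lip by (intro hausdorff_measure_lipschitz) blast
  finally show ?thesis .
qed

section \<open>Balls of a multiradial distance\<close>

text \<open>Monotonicity is given for one variable at a time; \<open>override_on\<close> replaces
  the coordinates of \<open>t\<close> by those of \<open>u\<close> successively.\<close>

lemma layerwise_mono:
  fixes \<phi> :: "(nat \<Rightarrow> real) \<Rightarrow> real"
  assumes mono: "\<And>t i s. t \<in> {1..\<iota>} \<rightarrow>\<^sub>E {0..} \<Longrightarrow> i \<in> {1..\<iota>} \<Longrightarrow> t i \<le> s \<Longrightarrow> \<phi> t \<le> \<phi> (t(i := s))"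
    and t: "t \<in> {1..\<iota>} \<rightarrow>\<^sub>E {0..}" and u: "u \<in> {1..\<iota>} \<rightarrow>\<^sub>E {0..}"
    and le: "\<And>i. i \<in> {1..\<iota>} \<Longrightarrow> t i \<le> u i"
  shows "\<phi> t \<le> \<phi> u"
proof -
  have "\<phi> t \<le> \<phi> (override_on t u J)" if "finite J" "J \<subseteq> {1..\<iota>}" for J
    using that
  proof (induction J)
    case (insert j J)
    have "override_on t u J \<in> {1..\<iota>} \<rightarrow>\<^sub>E {0..}"
      using t u by (auto simp: override_on_def PiE_iff extensional_def)
    moreover have "override_on t u J j = t j" using insert by simp
    ultimately have "\<phi> (override_on t u J) \<le> \<phi> ((override_on t u J)(j := u j))"
      using insert.prems le by (intro mono) auto
    moreover have "override_on t u (insert j J) = (override_on t u J)(j := u j)"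
      by (auto simp: override_on_def)
    moreover have "\<phi> t \<le> \<phi> (override_on t u J)" using insert by simp
    ultimately show ?case by (metis order_trans)
  qed simp
  moreover have "override_on t u {1..\<iota>} = u"
    using t u by (auto simp: override_on_def PiE_iff extensional_def fun_eq_iff)
  ultimately show ?thesis by (metis finite_atLeastAtMost order_refl)
qed

lemma multiradial_unit_ball:
  assumes "multiradial_distance br H \<iota> d"
  shows "closed (closed_ball d 0 1)" "bounded (closed_ball d 0 1)"
    "layer_solid H \<iota> (closed_ball d 0 1)"
proof -
  let ?E = "{1..\<iota>} \<rightarrow>\<^sub>E {0::real..}"
  obtain \<phi> :: "(nat \<Rightarrow> real) \<Rightarrow> real" where
    cont: "continuous_map (product_topology (\<lambda>_. top_of_set {0..}) {1..\<iota>}) (top_of_set {0..}) \<phi>"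
    and mono: "\<forall>t \<in> ?E. \<forall>i\<in>{1..\<iota>}. \<forall>s\<ge>t i. \<phi> t \<le> \<phi> (t(i := s))"
    and coercive: "\<forall>M. \<exists>R. \<forall>t \<in> ?E. R \<le> L2_set t {1..\<iota>} \<longrightarrow> M \<le> \<phi> t"
    and ball: "closed_ball d 0 1 = {x. \<phi> (\<lambda>i\<in>{1..\<iota>}. norm (P i x)) \<le> 1}"
    using assms unfolding multiradial_distance_def by blast
  define \<nu> where "\<nu> x = (\<lambda>i\<in>{1..\<iota>}. norm (P i x))" for x
  have \<nu>: "\<nu> x \<in> ?E" for x by (simp add: \<nu>_def)
  have "continuous_map euclidean (top_of_set {0..}) (\<lambda>x. \<nu> x i)" if "i \<in> {1..\<iota>}" for i
    using that linear_continuous_on[OF linear_conv_bounded_linear[THEN iffD1, OF linear_layer_proj[OF that]], of UNIV]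
    by (simp add: \<nu>_def continuous_map_in_subtopology continuous_on_norm image_subset_iff)
  then have "continuous_map euclidean (product_topology (\<lambda>_. top_of_set {0..}) {1..\<iota>}) \<nu>"
    using \<nu> by (auto simp: continuous_map_componentwise PiE_iff)
  then have "continuous_map euclidean (top_of_set {0..}) (\<lambda>x. \<phi> (\<nu> x))"
    using continuous_map_compose[OF _ cont] by (simp add: comp_def)
  then have "continuous_on UNIV (\<lambda>x. \<phi> (\<nu> x))"
    by (simp add: continuous_map_in_subtopology)
  then show "closed (closed_ball d 0 1)"
    unfolding ball \<nu>_def[symmetric] by (intro closed_Collect_le continuous_intros)
  show "layer_solid H \<iota> (closed_ball d 0 1)"
    unfolding layer_solid_def
  proof (intro ballI allI impI)
    fix x y assume x: "x \<in> closed_ball d 0 1"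
      and le: "\<forall>i\<in>{1..\<iota>}. norm (P i y) \<le> norm (P i x)"
    have "\<phi> (\<nu> y) \<le> \<phi> (\<nu> x)"
    proof (rule layerwise_mono[where \<phi> = \<phi>])
      show "\<phi> t \<le> \<phi> (t(i := s))" if "t \<in> ?E" "i \<in> {1..\<iota>}" "t i \<le> s" for t i s
        using mono that by blast
      show "\<nu> y i \<le> \<nu> x i" if "i \<in> {1..\<iota>}" for i
        using le that by (simp add: \<nu>_def)
    qed (rule \<nu>)+
    then show "y \<in> closed_ball d 0 1" using x by (simp add: ball \<nu>_def)
  qed
  \<comment> \<open>Any bound above 1 serves in place of 2. The vector of layer norms has Euclidean
    norm \<open>norm x\<close>, by orthogonality of the layers.\<close>
  obtain R where R: "\<And>t. t \<in> ?E \<Longrightarrow> R \<le> L2_set t {1..\<iota>} \<Longrightarrow> 2 \<le> \<phi> t"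
    using coercive by blast
  have "norm x \<le> R" if "x \<in> closed_ball d 0 1" for x
  proof -
    have "\<phi> (\<nu> x) \<le> 1" using that by (simp add: ball \<nu>_def)
    then have "L2_set (\<nu> x) {1..\<iota>} \<le> R" using R[OF \<nu>, of x] by linarith
    moreover have "(norm x)\<^sup>2 = (\<Sum>i\<in>{1..\<iota>}. (\<nu> x i)\<^sup>2)"
      using norm_layer_sum[of "\<lambda>i. P i x"] layer_proj_in layer_proj_spec(2)[of x]
      by (simp add: \<nu>_def del: One_nat_def)
    then have "L2_set (\<nu> x) {1..\<iota>} = norm x"
      by (metis L2_set_def norm_ge_zero real_sqrt_unique)
    ultimately show ?thesis by simp
  qed
  then show "bounded (closed_ball d 0 1)"
    unfolding bounded_iff by blast
qed

text \<open>Left translation by \<open>- z\<close> preserves the distance and sends \<open>z\<close>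
  to 0.\<close>

lemma closed_ball_translate:
  assumes "homogeneous_distance br H \<iota> d"
  shows "closed_ball d z 1 = {x. group_mult br \<iota> (- z) x \<in> closed_ball d 0 1}"
proof -
  interpret Metric_space UNIV d
    using assms by (simp add: homogeneous_distance_def)
  have "d (group_mult br \<iota> (- z) z) (group_mult br \<iota> (- z) x) = d z x" for x
    using assms unfolding homogeneous_distance_def by blast
  then show ?thesis by (auto simp: group_mult_inverse)
qed

lemma spherical_factor_layer_sum:
  assumes W: "\<And>i. i \<in> {1..\<iota>} \<Longrightarrow> subspace (W i)" "\<And>i. i \<in> {1..\<iota>} \<Longrightarrow> W i \<subseteq> H i"
    and d: "multiradial_distance br H \<iota> d"
  shows "spherical_factor d (layer_sum \<iota> W)
    = hausdorff_measure (dim (layer_sum \<iota> W)) (layer_sum \<iota> W \<inter> closed_ball d 0 1)"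
  unfolding spherical_factor_def
proof (rule antisym)
  have hom: "homogeneous_distance br H \<iota> d"
    using d by (simp add: multiradial_distance_def)
  interpret Metric_space UNIV d
    using hom by (simp add: homogeneous_distance_def)
  let ?\<mu> = "hausdorff_measure (dim (layer_sum \<iota> W))"
  show "(SUP z\<in>closed_ball d 0 1. ?\<mu> (layer_sum \<iota> W \<inter> closed_ball d z 1))
      \<le> ?\<mu> (layer_sum \<iota> W \<inter> closed_ball d 0 1)"
  proof (rule SUP_least)
    fix z
    show "?\<mu> (layer_sum \<iota> W \<inter> closed_ball d z 1) \<le> ?\<mu> (layer_sum \<iota> W \<inter> closed_ball d 0 1)"
      unfolding closed_ball_translate[OF hom, of z]
      using W refl borel_closed[OF multiradial_unit_ball(1)[OF d]] multiradial_unit_ball(3)[OF d]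
      by (rule hausdorff_measure_slice_le)
  qed
  \<comment> \<open>The centre 0 is admissible in the supremum, so the bound is attained
    there.\<close>
  show "?\<mu> (layer_sum \<iota> W \<inter> closed_ball d 0 1)
      \<le> (SUP z\<in>closed_ball d 0 1. ?\<mu> (layer_sum \<iota> W \<inter> closed_ball d z 1))"
    by (rule SUP_upper) simp
qed

end

section \<open>Rotational symmetry of multiradial distances\<close>

theorem theorem3p3:
  fixes br :: "'a::euclidean_space \<Rightarrow> 'a \<Rightarrow> 'a"
    and H :: "nat \<Rightarrow> 'a set"
    and \<iota> :: nat
    and d :: "'a \<Rightarrow> 'a \<Rightarrow> real"
    and n :: "nat \<Rightarrow> nat"
  assumes "graded_group br H \<iota>"
    and "multiradial_distance br H \<iota> d"
    and "\<forall>i\<in>{1..\<iota>}. 1 \<le> n i \<and> n i \<le> DIM('a) - 1"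
    and "subspace_family H \<iota> n \<noteq> {}"
  shows "rotationally_symmetric H \<iota> d (subspace_family H \<iota> n) \<and>
    (\<exists>\<omega>\<ge>0. \<forall>V\<in>subspace_family H \<iota> n.
       ennreal \<omega> = spherical_factor d V \<and>
       spherical_factor d V = hausdorff_measure (\<Sum>i\<in>{1..\<iota>}. n i) (V \<inter> closed_ball d 0 1))"
proof -
  interpret graded_group br H \<iota> by fact
  let ?N = "\<Sum>i\<in>{1..\<iota>}. n i" and ?B = "closed_ball d 0 1"
  have family: "\<exists>W. (\<forall>i\<in>{1..\<iota>}. subspace (W i) \<and> W i \<subseteq> H i \<and> dim (W i) = n i) \<and>
      V = layer_sum \<iota> W" if "V \<in> subspace_family H \<iota> n" for V
    using that by (auto simp: subspace_family_def layer_sum_def)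
  have fact: "spherical_factor d V = hausdorff_measure ?N (V \<inter> ?B) \<and> hausdorff_measure ?N (V \<inter> ?B) < top"
    if VF: "V \<in> subspace_family H \<iota> n" for V
  proof -
    obtain W where W: "\<And>i. i \<in> {1..\<iota>} \<Longrightarrow> subspace (W i)" "\<And>i. i \<in> {1..\<iota>} \<Longrightarrow> W i \<subseteq> H i"
      and dim: "\<And>i. i \<in> {1..\<iota>} \<Longrightarrow> dim (W i) = n i" and V: "V = layer_sum \<iota> W"
      using family[OF VF] by blast
    have dimV: "dim V = ?N"
      unfolding V using dim by (subst dim_layer_sum[OF W]) simp_all
    have "subspace V" unfolding V using W by (rule subspace_layer_sum)
    moreover have "bounded (V \<inter> ?B)"
      using multiradial_unit_ball(2)[OF assms(2)] bounded_Int by blast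
    ultimately have "hausdorff_measure (dim V) (V \<inter> ?B) < top"
      by (intro hausdorff_measure_bounded_subspace) auto
    moreover have "spherical_factor d V = hausdorff_measure (dim V) (V \<inter> ?B)"
      unfolding V using W assms(2) by (rule spherical_factor_layer_sum)
    ultimately show ?thesis by (simp only: dimV)
  qed
  \<comment> \<open>Used in both directions below, this makes the measure of the slice constant on
    the family.\<close>
  have le: "hausdorff_measure ?N (V' \<inter> ?B) \<le> hausdorff_measure ?N (V \<inter> ?B)"
    if VF: "V \<in> subspace_family H \<iota> n" "V' \<in> subspace_family H \<iota> n" for V V'
  proof -
    obtain W where W: "\<And>i. i \<in> {1..\<iota>} \<Longrightarrow> subspace (W i)" "\<And>i. i \<in> {1..\<iota>} \<Longrightarrow> W i \<subseteq> H i"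
      "\<And>i. i \<in> {1..\<iota>} \<Longrightarrow> dim (W i) = n i" "V = layer_sum \<iota> W"
      using family[OF VF(1)] by blast
    obtain W' where W': "\<And>i. i \<in> {1..\<iota>} \<Longrightarrow> subspace (W' i)" "\<And>i. i \<in> {1..\<iota>} \<Longrightarrow> W' i \<subseteq> H i"
      "\<And>i. i \<in> {1..\<iota>} \<Longrightarrow> dim (W' i) = n i" "V' = layer_sum \<iota> W'"
      using family[OF VF(2)] by blast
    have "dim (W i) = dim (W' i)" if "i \<in> {1..\<iota>}" for i
      using W(3) W'(3) that by simp
    then show ?thesis
      unfolding W(4) W'(4) using W(1,2) W'(1,2) multiradial_unit_ball(3)[OF assms(2)]
      by (intro hausdorff_measure_layer_sum_le)
  qed
  obtain V0 where V0: "V0 \<in> subspace_family H \<iota> n" using assms(4) by blast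
  have const: "spherical_factor d V = hausdorff_measure ?N (V0 \<inter> ?B)"
    if "V \<in> subspace_family H \<iota> n" for V
    using fact[OF that] le[OF that V0] le[OF V0 that] by simp
  \<comment> \<open>The slice has finite measure because the unit ball is bounded, so the common
    value is a real number.\<close>
  obtain \<omega> where \<omega>: "0 \<le> \<omega>" "ennreal \<omega> = hausdorff_measure ?N (V0 \<inter> ?B)"
    using fact[OF V0] by (metis less_top_ennreal)
  show ?thesis
  proof
    show "rotationally_symmetric H \<iota> d (subspace_family H \<iota> n)"
      using const assms(4) by (auto simp: rotationally_symmetric_def subspace_family_def)
    show "\<exists>\<omega>\<ge>0. \<forall>V\<in>subspace_family H \<iota> n. ennreal \<omega> = spherical_factor d V \<and>
        spherical_factor d V = hausdorff_measure ?N (V \<inter> ?B)"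
      using \<omega> const fact by (intro exI[of _ \<omega>] conjI ballI) auto
  qed
qed

end
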